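(* Let $K$ be a kernel. Kernel linkage $\mathrm{L}^K$ is uniformly continuous with respect to the Gromov--Hausdorff--Prokhorov distance on compact metric probability spaces and the correspondence-interleaving distance on $3$-parameter hierarchical clusterings: for every $\epsilon>0$ there is $\delta>0$ such that for all compact metric probability spaces $\mathcal{M},\mathcal{N}$ with $d_{\mathrm{GHP}}(\mathcal{M},\mathcal{N})<\delta$ we have $d_{\mathrm{CI}}(\mathrm{L}^K(\mathcal{M}),\mathrm{L}^K(\mathcal{N}))<\epsilon$. Moreover, if $K$ is the uniform kernel, then $\mathrm{L}^K$ is $2$-Lipschitz: $d_{\mathrm{CI}}(\mathrm{L}^K(\mathcal{M}),\mathrm{L}^K(\mathcal{N}))\le 2\, d_{\mathrm{GHP}}(\mathcal{M},\mathcal{N})$ for all compact metric probability spaces $\mathcal{M},\mathcal{N}$.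
   Context: Hierarchical clusterings. A clustering of a set $X$ is a set of non-empty, pairwise disjoint subsets of $X$. $\mathsf{C}(X)$ is the poset of clusterings, where $S\preceq T$ if every $A\in S$ is contained in some $B\in T$. An $n$-parameter hierarchical clustering (HC) of $X$ is an order-preserving map $H:P\to\mathsf{C}(X)$, where $P=I_1\times\dots\times I_n$ (product order) and each $I_j$ is an interval of $\mathbb{R}$ or of $\mathbb{R}^{\mathrm{op}}$ (opposite order). Its extension $\bar H:\mathbb{R}^n\to\mathsf{C}(X)$: let $P'$ be obtained by replacing each $I_j\subseteq\mathbb{R}^{\mathrm{op}}$ by $-I_j\subseteq\mathbb{R}$, and $\rho:P'\to P$ the isomorphism negating those coordinates; $\bar H(r)=H(\rho(r))$ if $r\in P'$; $\bar H(r)=\{X\}$ if $r\notin P'$ and there is $p\in P'$ with $p<r$; $\bar H(r)=\emptyset$ otherwise. For $\vec\epsilon\in\mathbb{R}_{\ge0}^n$, two HCs $H,E$ of the same set are $\vec\epsilon$-interleaved if $\bar H(\vec r)\preceq\bar E(\vec r+\vec\epsilon)$ and $\bar E(\vec r)\preceq\bar H(\vec r+\vec\epsilon)$ for all $\vec r\in\mathbb{R}^n$. A correspondence between $X$ and $Y$ is $R\subseteq X\times Y$ with surjective projections $\pi_X,\pi_Y$. For $\psi:Y\to X$, $\psi^*(\{C_i\})=\{\psi^{-1}(C_i)\}$ and $\psi^*(H)=\psi^*\circ H$. $H$ (of $X$) and $E$ (of $Y$) are $\vec\epsilon$-interleaved with respect to $R$ if $\pi_X^*(H),\pi_Y^*(E)$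 are $\vec\epsilon$-interleaved. $d_{\mathrm{CI}}(H,E)$ is the infimum of $\epsilon\ge0$ such that $H,E$ are $(\epsilon,\dots,\epsilon)$-interleaved with respect to some correspondence. Metric probability spaces. A metric probability space is a metric space $\mathcal{M}$ with a Borel probability measure $\mu_{\mathcal{M}}$. For subsets of a metric space $Z$, $W^\epsilon=\{z:\exists w\in W, d_Z(z,w)<\epsilon\}$; $d_{\mathrm{H}}^Z(A,B)=\inf\{\epsilon>0: A\subseteq B^\epsilon, B\subseteq A^\epsilon\}$; the Prokhorov distance is $d_{\mathrm{P}}(\mu,\nu)=\inf\{\epsilon>0:\mu(A)\le\nu(A^\epsilon)+\epsilon,\ \nu(A)\le\mu(A^\epsilon)+\epsilon \text{ for all Borel } A\}$. For compact metric probability spaces, $d_{\mathrm{GHP}}(\mathcal{M},\mathcal{N})=\inf_{i,j}\max\big(d_{\mathrm{H}}^Z(i(\mathcal{M}),j(\mathcal{N})),d_{\mathrm{P}}(i_*\mu_{\mathcal{M}},j_*\mu_{\mathcal{N}})\big)$ over isometric embeddings $i:\mathcal M\to Z$, $j:\mathcal N\to Z$ into a common metric space $Z$. Kernel linkage. A kernel is a non-increasing function $K:\mathbb{R}_{\ge0}\to\mathbb{R}_{\ge0}$, continuous from the right, with $0<\int_0^\infty K(r)\,dr<\infty$. The uniform kernel is $K(r)=1$ for $r<1$ and $K(r)=0$ otherwise. For $s,k>0$ let $\mathcal{M}_{[s,k]}=\{x\in\mathcal{M}:\int_{\mathcal{M}}K(d_{\mathcal{M}}(x,x')/s)\,d\mu_{\mathcal{M}}(x')\ge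 k\}$. For a metric space $M$ and $t>0$, single-linkage $\mathrm{SL}(M)(t)$ is the partition of $M$ by the smallest equivalence relation with $x\sim y$ whenever $d_M(x,y)\le t$. The kernel linkage of $\mathcal{M}$ is the $3$-parameter HC $\mathrm{L}^K(\mathcal{M}):\mathbb{R}_{>0}\times\mathbb{R}_{>0}\times\mathbb{R}_{>0}^{\mathrm{op}}\to\mathsf{C}(\mathcal{M})$, $(s,t,k)\mapsto\mathrm{SL}(\mathcal{M}_{[s,k]})(t)$. *)

theory Defs
  imports "HOL-Probability.Probability_Measure"
begin

section \<open>Clusterings and multi-parameter hierarchical clusterings\<close>

definition clustering :: "'a set \<Rightarrow> 'a set set \<Rightarrow> bool" where
  "clustering X S \<longleftrightarrow> (\<forall>A\<in>S. A \<subseteq> X \<and> A \<noteq> {}) \<and> (\<forall>A\<in>S. \<forall>B\<in>S. A \<noteq> B \<longrightarrow> A \<inter> B = {})"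

definition refines :: "'a set set \<Rightarrow> 'a set set \<Rightarrow> bool"  (infix \<open>\<preceq>\<close> 50) where
  "S \<preceq> T \<longleftrightarrow> (\<forall>A\<in>S. \<exists>B\<in>T. A \<subseteq> B)"

text \<open>
  A hierarchical clustering of the set \<open>hc_set H\<close> with parameters indexed by the finite type
  \<open>'n\<close>.  The parameter poset is the product of the intervals \<open>hc_ivl H j\<close>, where the \<open>j\<close>-th
  factor carries the opposite order iff \<open>hc_op H j\<close>.  The values of \<open>hc_map H\<close> outside this
  product are irrelevant.
\<close>

record ('a, 'n) hc =
  hc_set :: "'a set"
  hc_ivl :: "'n \<Rightarrow> real set"
  hc_op  :: "'n \<Rightarrow> bool"
  hc_map :: "real^'n \<Rightarrow> 'a set set"

definition hc_params :: "('a, 'n::finite) hc \<Rightarrow> (real^'n) set" where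
  "hc_params H = {p. \<forall>j. p $ j \<in> hc_ivl H j}"

definition hc_params_le :: "('a, 'n::finite) hc \<Rightarrow> real^'n \<Rightarrow> real^'n \<Rightarrow> bool" where
  "hc_params_le H p q \<longleftrightarrow> (\<forall>j. if hc_op H j then q $ j \<le> p $ j else p $ j \<le> q $ j)"

definition hierarchical_clustering :: "('a, 'n::finite) hc \<Rightarrow> bool" where
  "hierarchical_clustering H \<longleftrightarrow>
     (\<forall>j. is_interval (hc_ivl H j)) \<and>
     (\<forall>p\<in>hc_params H. clustering (hc_set H) (hc_map H p)) \<and>
     (\<forall>p\<in>hc_params H. \<forall>q\<in>hc_params H. hc_params_le H p q \<longrightarrow> hc_map H p \<preceq> hc_map H q)"

definition hc_neg :: "('a, 'n::finite) hc \<Rightarrow> real^'n \<Rightarrow> real^'n" where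
  "hc_neg H r = (\<chi> j. if hc_op H j then - (r $ j) else r $ j)"

text \<open>
  \<open>hc_neg H\<close> is an involution, so the poset obtained by negating the contravariant factors is
  the preimage of \<open>hc_params H\<close> under it.
\<close>

definition hc_params' :: "('a, 'n::finite) hc \<Rightarrow> (real^'n) set" where
  "hc_params' H = {r. hc_neg H r \<in> hc_params H}"

definition hc_ext :: "('a, 'n::finite) hc \<Rightarrow> real^'n \<Rightarrow> 'a set set" where
  "hc_ext H r =
     (if r \<in> hc_params' H then hc_map H (hc_neg H r)
      else if \<exists>p\<in>hc_params' H. p < r then {hc_set H}
      else {})"

definition interleaved ::
    "real^'n::finite \<Rightarrow> ('a, 'n) hc \<Rightarrow> ('a, 'n) hc \<Rightarrow> bool" where
  "interleaved \<epsilon> H E \<longleftrightarrow>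
     hc_set H = hc_set E \<and>
     (\<forall>r. hc_ext H r \<preceq> hc_ext E (r + \<epsilon>) \<and> hc_ext E r \<preceq> hc_ext H (r + \<epsilon>))"

definition correspondence :: "'a set \<Rightarrow> 'b set \<Rightarrow> ('a \<times> 'b) set \<Rightarrow> bool" where
  "correspondence X Y R \<longleftrightarrow> R \<subseteq> X \<times> Y \<and> fst ` R = X \<and> snd ` R = Y"

definition clustering_pullback :: "('b \<Rightarrow> 'a) \<Rightarrow> 'b set \<Rightarrow> 'a set set \<Rightarrow> 'b set set" where
  "clustering_pullback \<psi> Y S = (\<lambda>C. \<psi> -` C \<inter> Y) ` S"

definition hc_pullback :: "('b \<Rightarrow> 'a) \<Rightarrow> 'b set \<Rightarrow> ('a, 'n::finite) hc \<Rightarrow> ('b, 'n) hc" where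
  "hc_pullback \<psi> Y H =
     \<lparr> hc_set = Y, hc_ivl = hc_ivl H, hc_op = hc_op H,
       hc_map = (\<lambda>p. clustering_pullback \<psi> Y (hc_map H p)) \<rparr>"

definition interleaved_wrt ::
    "('a \<times> 'b) set \<Rightarrow> real^'n::finite \<Rightarrow> ('a, 'n) hc \<Rightarrow> ('b, 'n) hc \<Rightarrow> bool" where
  "interleaved_wrt R \<epsilon> H E \<longleftrightarrow> interleaved \<epsilon> (hc_pullback fst R H) (hc_pullback snd R E)"

text \<open>The distances below are extended: an infimum over the empty set is \<open>\<infinity>\<close>.\<close>

definition CI_dist :: "('a, 'n::finite) hc \<Rightarrow> ('b, 'n) hc \<Rightarrow> ennreal" where
  "CI_dist H E = Inf {ennreal \<epsilon> | \<epsilon>. 0 \<le> \<epsilon> \<and>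
     (\<exists>R. correspondence (hc_set H) (hc_set E) R \<and> interleaved_wrt R (\<chi> j. \<epsilon>) H E)}"

section \<open>Metric probability spaces and the Gromov--Hausdorff--Prokhorov distance\<close>

record 'a mm_space =
  mm_metric  :: "'a metric"
  mm_measure :: "'a measure"

definition mborel :: "'a metric \<Rightarrow> 'a measure" where
  "mborel Z = sigma (mspace Z) {U. openin (mtopology_of Z) U}"

definition metric_prob_space :: "'a mm_space \<Rightarrow> bool" where
  "metric_prob_space M \<longleftrightarrow>
     sets (mm_measure M) = sets (mborel (mm_metric M)) \<and> prob_space (mm_measure M)"

definition compact_metric_prob_space :: "'a mm_space \<Rightarrow> bool" where
  "compact_metric_prob_space M \<longleftrightarrow>
     metric_prob_space M \<and> compact_space (mtopology_of (mm_metric M))"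

definition thickening :: "'z metric \<Rightarrow> 'z set \<Rightarrow> real \<Rightarrow> 'z set" where
  "thickening Z W \<epsilon> = {z \<in> mspace Z. \<exists>w\<in>W. mdist Z z w < \<epsilon>}"

definition hausdorff_dist :: "'z metric \<Rightarrow> 'z set \<Rightarrow> 'z set \<Rightarrow> ennreal" where
  "hausdorff_dist Z A B =
     Inf {ennreal \<epsilon> | \<epsilon>. 0 < \<epsilon> \<and> A \<subseteq> thickening Z B \<epsilon> \<and> B \<subseteq> thickening Z A \<epsilon>}"

definition prokhorov_dist :: "'z metric \<Rightarrow> 'z measure \<Rightarrow> 'z measure \<Rightarrow> ennreal" where
  "prokhorov_dist Z \<mu> \<nu> =
     Inf {ennreal \<epsilon> | \<epsilon>. 0 < \<epsilon> \<and> (\<forall>A\<in>sets (mborel Z).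
       emeasure \<mu> A \<le> emeasure \<nu> (thickening Z A \<epsilon>) + ennreal \<epsilon> \<and>
       emeasure \<nu> A \<le> emeasure \<mu> (thickening Z A \<epsilon>) + ennreal \<epsilon>)}"

definition isometric_embedding :: "'a metric \<Rightarrow> 'z metric \<Rightarrow> ('a \<Rightarrow> 'z) \<Rightarrow> bool" where
  "isometric_embedding m Z i \<longleftrightarrow>
     i ` mspace m \<subseteq> mspace Z \<and>
     (\<forall>x\<in>mspace m. \<forall>y\<in>mspace m. mdist Z (i x) (i y) = mdist m x y)"

text \<open>
  HOL cannot quantify over the type carrying the common metric space \<open>Z\<close>, so that type is a
  parameter.  The Gromov--Hausdorff--Prokhorov distance is the infimum of
  \<open>GHP_dist TYPE('z) M N\<close> over all types \<open>'z\<close>; hence an upper bound in terms of it has to be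
  stated for a free type variable \<open>'z\<close>.  For compact \<open>M\<close> and \<open>N\<close> the infimum is attained as soon
  as \<open>'z\<close> has at least the cardinality of the continuum, since \<open>Z\<close> may be replaced by the
  union of the two images, which is compact.  If \<open>'z\<close> is too small to receive
  both spaces, the value is \<open>\<infinity>\<close>.
\<close>

definition GHP_dist ::
    "'z itself \<Rightarrow> 'a mm_space \<Rightarrow> 'b mm_space \<Rightarrow> ennreal" where
  "GHP_dist _ M N =
     Inf {max (hausdorff_dist Z (i ` mspace (mm_metric M)) (j ` mspace (mm_metric N)))
              (prokhorov_dist Z (distr (mm_measure M) (mborel Z) i)
                                (distr (mm_measure N) (mborel Z) j))
          | (Z :: 'z metric) i j.
              isometric_embedding (mm_metric M) Z i \<and> isometric_embedding (mm_metric N) Z j}"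

section \<open>Kernel linkage\<close>

definition kernel_function :: "(real \<Rightarrow> real) \<Rightarrow> bool" where
  "kernel_function K \<longleftrightarrow>
     (\<forall>r\<ge>0. 0 \<le> K r) \<and> antimono_on {0..} K \<and> (\<forall>r\<ge>0. continuous (at_right r) K) \<and>
     0 < (\<integral>\<^sup>+r\<in>{0..}. ennreal (K r) \<partial>lborel) \<and> (\<integral>\<^sup>+r\<in>{0..}. ennreal (K r) \<partial>lborel) < \<infinity>"

definition uniform_kernel :: "real \<Rightarrow> real" where
  "uniform_kernel r = (if r < 1 then 1 else 0)"

definition dense_points ::
    "(real \<Rightarrow> real) \<Rightarrow> 'a mm_space \<Rightarrow> real \<Rightarrow> real \<Rightarrow> 'a set" where
  "dense_points K M s k = {x \<in> mspace (mm_metric M).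
     k \<le> (\<integral>x'. K (mdist (mm_metric M) x x' / s) \<partial>mm_measure M)}"

definition sl_rel :: "'a metric \<Rightarrow> real \<Rightarrow> ('a \<times> 'a) set" where
  "sl_rel m t = \<Inter> {E. equiv (mspace m) E \<and>
     {(x, y). x \<in> mspace m \<and> y \<in> mspace m \<and> mdist m x y \<le> t} \<subseteq> E}"

definition single_linkage :: "'a metric \<Rightarrow> real \<Rightarrow> 'a set set" where
  "single_linkage m t = mspace m // sl_rel m t"

text \<open>The coordinates 1, 2, 3 are \<open>s\<close>, \<open>t\<close>, \<open>k\<close>; only the last one is contravariant.\<close>

definition kernel_linkage :: "(real \<Rightarrow> real) \<Rightarrow> 'a mm_space \<Rightarrow> ('a, 3) hc" where
  "kernel_linkage K M =
     \<lparr> hc_set = mspace (mm_metric M), hc_ivl = (\<lambda>_. {0<..}), hc_op = (\<lambda>j. j = 3),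
       hc_map = (\<lambda>p. single_linkage
         (submetric (mm_metric M) (dense_points K M (p $ 1) (p $ 3))) (p $ 2)) \<rparr>"

text \<open>
  The pair \<open>(\<epsilon>, \<delta>)\<close> witnesses uniform continuity for all spaces with points in \<open>'a\<close> and \<open>'b\<close>
  and all common metric spaces with points in \<open>'z\<close>.  An \<open>\<exists>\<delta>\<close> in front of this would allow
  \<open>\<delta>\<close> to depend on the three types.  A \<open>\<delta>\<close> that does not can be expressed by asking for one
  that works at the type \<open>real\<close>, which contains an isometric copy of every compact metric
  space (as a set with its own metric), and that every such \<open>\<delta>\<close> works at all types.
\<close>

definition linkage_modulus ::
    "'a itself \<Rightarrow> 'b itself \<Rightarrow> 'z itself \<Rightarrow> (real \<Rightarrow> real) \<Rightarrow> real \<Rightarrow> real \<Rightarrow> bool" where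
  "linkage_modulus _ _ _ K \<epsilon> \<delta> \<longleftrightarrow>
     (\<forall>(M :: 'a mm_space) (N :: 'b mm_space).
        compact_metric_prob_space M \<longrightarrow> compact_metric_prob_space N \<longrightarrow>
        GHP_dist TYPE('z) M N < ennreal \<delta> \<longrightarrow>
        CI_dist (kernel_linkage K M) (kernel_linkage K N) < ennreal \<epsilon>)"

section \<open>Kernel linkage is a hierarchical clustering\<close>

lemma equiv_sl_rel: "equiv (mspace m) (sl_rel m t)"
proof -
  let ?A = "mspace m"
  let ?F = "{E. equiv ?A E \<and> {(x, y). x \<in> ?A \<and> y \<in> ?A \<and> mdist m x y \<le> t} \<subseteq> E}"
  have top: "?A \<times> ?A \<in> ?F"
    by (auto intro!: equivI refl_onI symI transI)
  show ?thesis
    unfolding sl_rel_def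
  proof (rule equivI)
    show "\<Inter> ?F \<subseteq> ?A \<times> ?A" using top by (rule Inter_lower)
    show "refl_on ?A (\<Inter> ?F)"
      by (rule refl_onI) (auto simp: equiv_def refl_on_def)
    show "sym (\<Inter> ?F)"
      by (rule symI) (auto simp: equiv_def sym_def)
    show "trans (\<Inter> ?F)"
    proof (rule transI)
      fix x y z assume "(x, y) \<in> \<Inter> ?F" "(y, z) \<in> \<Inter> ?F"
      then have "(x, z) \<in> E" if "E \<in> ?F" for E
        using that transD[of E x y z] by (auto simp only: equiv_def Inter_iff mem_Collect_eq)
      then show "(x, z) \<in> \<Inter> ?F" by blast
    qed
  qed
qed

lemma clustering_single_linkage: "clustering (mspace m) (single_linkage m t)"
  unfolding clustering_def single_linkage_def
  by (metis equiv_sl_rel quotient_disj in_quotient_imp_non_empty in_quotient_imp_subset)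

lemma single_linkage_mono:
  assumes "A \<subseteq> B" "B \<subseteq> mspace m" "t \<le> u"
  shows "single_linkage (submetric m A) t \<preceq> single_linkage (submetric m B) u"
proof -
  have A: "mspace (submetric m A) = A" and B: "mspace (submetric m B) = B"
    using assms by auto
  let ?F = "sl_rel (submetric m B) u"
  have eq: "equiv B ?F" using equiv_sl_rel[of "submetric m B" u] unfolding B .
  have "equiv A (?F \<inter> A \<times> A)"
    using eq assms(1) unfolding equiv_def refl_on_def sym_def trans_def by blast
  moreover have "{(x, y). x \<in> A \<and> y \<in> A \<and> mdist m x y \<le> t} \<subseteq> ?F \<inter> A \<times> A"
    using assms unfolding sl_rel_def B by auto
  ultimately have sub: "sl_rel (submetric m A) t \<subseteq> ?F"
    unfolding sl_rel_def[of "submetric m A"] A mdist_submetric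
    by (intro Inter_lower[THEN order_trans, of "?F \<inter> A \<times> A"]) auto
  show ?thesis
    unfolding refines_def single_linkage_def A B
  proof
    fix C assume "C \<in> A // sl_rel (submetric m A) t"
    then obtain x where "x \<in> A" "C = sl_rel (submetric m A) t `` {x}"
      by (auto elim: quotientE)
    then show "\<exists>D\<in>B // ?F. C \<subseteq> D"
      using assms(1) sub by (intro bexI[of _ "?F `` {x}"] quotientI) auto
  qed
qed

lemma borel_measurable_mdist:
  assumes "metric_prob_space M" "x \<in> mspace (mm_metric M)"
  shows "(\<lambda>x'. mdist (mm_metric M) x x') \<in> borel_measurable (mm_measure M)"
proof -
  interpret Metric_space "mspace (mm_metric M)" "mdist (mm_metric M)" by simp
  have "{U. openin (mtopology_of (mm_metric M)) U} \<subseteq> Pow (mspace (mm_metric M))"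
    using openin_subset[of "mtopology_of (mm_metric M)"] by auto
  then have sets: "sets (mm_measure M) = sigma_sets (mspace (mm_metric M))
      {U. openin (mtopology_of (mm_metric M)) U}"
    and space: "space (mm_measure M) = mspace (mm_metric M)"
    using assms(1) sets_eq_imp_space_eq[of "mm_measure M" "mborel (mm_metric M)"]
    by (simp_all add: metric_prob_space_def mborel_def)
  show ?thesis
    unfolding borel_measurable_iff_less space
  proof
    fix a
    have "{y \<in> mspace (mm_metric M). mdist (mm_metric M) x y < a} = mball x a"
      using assms(2) by auto
    moreover have "openin (mtopology_of (mm_metric M)) (mball x a)"
      by (simp add: mtopology_of_def)
    ultimately show "{y \<in> mspace (mm_metric M). mdist (mm_metric M) x y < a}
        \<in> sets (mm_measure M)"
      by (simp add: sets)
  qed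
qed

lemma integrable_kernel:
  assumes "kernel_function K" "metric_prob_space M" "x \<in> mspace (mm_metric M)" "0 < s"
  shows "integrable (mm_measure M) (\<lambda>x'. K (mdist (mm_metric M) x x' / s))"
proof -
  interpret prob_space "mm_measure M" using assms(2) by (simp add: metric_prob_space_def)
  have K: "antimono_on {0..} K" "\<And>r. 0 \<le> r \<Longrightarrow> 0 \<le> K r"
    using assms(1) by (auto simp: kernel_function_def)
  have "mono_on UNIV (\<lambda>r. - K (max 0 r))"
    using K(1) by (auto simp: monotone_on_def max_def)
  from borel_measurable_mono_on_fnc[OF this]
  have "(\<lambda>r. - K (max 0 r)) \<in> borel_measurable borel" by simp
  then have "(\<lambda>r. K (max 0 r)) \<in> borel_measurable borel" by simp
  moreover have "(\<lambda>x'. mdist (mm_metric M) x x' / s) \<in> borel_measurable (mm_measure M)"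
    using borel_measurable_mdist[OF assms(2,3)] by measurable
  ultimately have "(\<lambda>x'. K (max 0 (mdist (mm_metric M) x x' / s)))
      \<in> borel_measurable (mm_measure M)"
    by measurable
  then have meas: "(\<lambda>x'. K (mdist (mm_metric M) x x' / s)) \<in> borel_measurable (mm_measure M)"
    using assms(4) by (simp add: max_def)
  have "norm (K (mdist (mm_metric M) x y / s)) \<le> K 0" for y
    using K assms(4) by (auto simp: monotone_on_def)
  then show ?thesis
    using meas by (intro integrable_const_bound[where B = "K 0"]) auto
qed

lemma dense_points_mono:
  assumes "kernel_function K" "metric_prob_space M" "0 < s" "s \<le> s'" "k' \<le> k"
  shows "dense_points K M s k \<subseteq> dense_points K M s' k'"
proof
  fix x assume x: "x \<in> dense_points K M s k"
  then have xM: "x \<in> mspace (mm_metric M)" by (simp add: dense_points_def)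
  have "K (mdist (mm_metric M) x y / s) \<le> K (mdist (mm_metric M) x y / s')" for y
  proof -
    have "mdist (mm_metric M) x y / s' \<le> mdist (mm_metric M) x y / s"
      using assms by (intro divide_left_mono) auto
    then show ?thesis
      using assms unfolding kernel_function_def monotone_on_def by auto
  qed
  then have "(\<integral>x'. K (mdist (mm_metric M) x x' / s) \<partial>mm_measure M)
      \<le> (\<integral>x'. K (mdist (mm_metric M) x x' / s') \<partial>mm_measure M)"
    using assms xM by (intro integral_mono integrable_kernel) auto
  with x assms(5) show "x \<in> dense_points K M s' k'"
    by (auto simp: dense_points_def)
qed

proposition hierarchical_clustering_kernel_linkage:
  assumes "kernel_function K" "metric_prob_space M"
  shows "hierarchical_clustering (kernel_linkage K M)"
proof -
  have "clustering (mspace (mm_metric M)) (single_linkage (submetric (mm_metric M) A) t)" for A t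
    using clustering_single_linkage[of "submetric (mm_metric M) A" t]
    by (auto simp: clustering_def)
  moreover have
    "single_linkage (submetric (mm_metric M) (dense_points K M (p $ 1) (p $ 3))) (p $ 2) \<preceq>
     single_linkage (submetric (mm_metric M) (dense_points K M (q $ 1) (q $ 3))) (q $ 2)"
    if "0 < p $ 1" "p $ 1 \<le> q $ 1" "p $ 2 \<le> q $ 2" "q $ 3 \<le> p $ 3" for p q :: "real^3"
    using that assms
    by (intro single_linkage_mono dense_points_mono) (auto simp: dense_points_def)
  ultimately show ?thesis
    by (auto simp: hierarchical_clustering_def kernel_linkage_def hc_params_def
        hc_params_le_def forall_3)
qed

end

theory Submission
  imports Defs
begin

text \<open>
  Embed both spaces into \<open>Z\<close> with Hausdorff and Prokhorov distance below \<open>e\<close> and let \<open>R\<close> relate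
  points at distance less than \<open>e\<close> in \<open>Z\<close>.  Distances between related pairs differ by at most
  \<open>2 * e\<close>, so chains of the single linkage carry over once \<open>t\<close> grows by \<open>2 * e\<close>.  For the density,
  write \<open>\<integral> K (d x x' / s)\<close> as the integral of the measures of its superlevel sets: the Prokhorov
  bound costs \<open>K 0 * e\<close>, and the shift of the argument is absorbed by enlarging \<open>s\<close> to \<open>s + \<eta>\<close>,
  except near \<open>0\<close>, where right continuity of \<open>K\<close> bounds the loss.  This gives a \<open>\<delta>\<close> depending only
  on \<open>K\<close> and \<open>\<epsilon>\<close>.

  To pass from a modulus for the type \<open>real\<close> to one for arbitrary types, note that the compact union
  of the two images in \<open>Z\<close> injects into the reals, and move both spaces along such an injection.
\<close>

section \<open>Borel sets and thickenings\<close>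

lemma openin_mtopology_of_subset:
  "{U. openin (mtopology_of Z) U} \<subseteq> Pow (mspace Z)"
  using openin_subset[of "mtopology_of Z"] by auto

lemma space_mborel [simp]: "space (mborel Z) = mspace Z"
  by (simp add: mborel_def space_measure_of openin_mtopology_of_subset)

lemma sets_mborel: "sets (mborel Z) = sigma_sets (mspace Z) {U. openin (mtopology_of Z) U}"
  by (simp add: mborel_def sets_measure_of openin_mtopology_of_subset)

lemma openin_imp_sets_mborel: "openin (mtopology_of Z) U \<Longrightarrow> U \<in> sets (mborel Z)"
  by (simp add: sets_mborel)

lemma closedin_imp_sets_mborel:
  assumes "closedin (mtopology_of Z) C" shows "C \<in> sets (mborel Z)"
proof -
  have "mspace Z - (mspace Z - C) \<in> sets (mborel Z)"
    using assms openin_imp_sets_mborel[of Z "mspace Z - C"] sets.compl_sets[of "mspace Z - C" "mborel Z"]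
    by (auto simp: closedin_def)
  moreover have "mspace Z - (mspace Z - C) = C"
    using closedin_subset[OF assms] by auto
  ultimately show ?thesis by simp
qed

text \<open>Compact sets are closed in a Hausdorff space. Later applied to the union of the two
  images, whose relatively Borel subsets are then Borel in the whole space.\<close>

lemma compactin_imp_sets_mborel:
  assumes "compactin (mtopology_of Z) C" shows "C \<in> sets (mborel Z)"
proof -
  interpret Metric_space "mspace Z" "mdist Z" by simp
  show ?thesis
    using assms compactin_imp_closedin[OF Hausdorff_space_mtopology]
    by (intro closedin_imp_sets_mborel) (simp add: mtopology_of_def)
qed

lemma measurable_mborel_continuous:
  assumes "continuous_map (mtopology_of m) (mtopology_of Z) f"
  shows "f \<in> measurable (mborel m) (mborel Z)"
  unfolding mborel_def[of Z]
proof (rule measurable_measure_of)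
  fix U assume "U \<in> {U. openin (mtopology_of Z) U}"
  then show "f -` U \<inter> space (mborel m) \<in> sets (mborel m)"
    using openin_continuous_map_preimage[OF assms, of U]
    by (intro openin_imp_sets_mborel) (simp add: vimage_def Int_def conj_commute)
qed (use continuous_map_image_subset_topspace[OF assms] openin_mtopology_of_subset[of Z] in auto)

lemma isometric_embedding_imp_continuous_map:
  assumes "isometric_embedding m Z i"
  shows "continuous_map (mtopology_of m) (mtopology_of Z) i"
  using assms
  by (intro Lipschitz_continuous_imp_continuous_map)
    (auto simp: Lipschitz_continuous_map_def isometric_embedding_def intro!: exI[of _ 1])

lemma space_mm_measure: "metric_prob_space M \<Longrightarrow> space (mm_measure M) = mspace (mm_metric M)"
  using sets_eq_imp_space_eq[of "mm_measure M" "mborel (mm_metric M)"]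
  by (simp add: metric_prob_space_def)

lemma measurable_isometric_embedding:
  assumes "metric_prob_space M" "isometric_embedding (mm_metric M) Z i"
  shows "i \<in> measurable (mm_measure M) (mborel Z)"
  using measurable_mborel_continuous[OF isometric_embedding_imp_continuous_map[OF assms(2)]] assms(1)
    measurable_cong_sets[of "mm_measure M" "mborel (mm_metric M)" "mborel Z" "mborel Z"]
  by (simp add: metric_prob_space_def)

lemma openin_thickening: 
  assumes "W \<subseteq> mspace Z" shows "openin (mtopology_of Z) (thickening Z W e)"
proof -
  interpret Metric_space "mspace Z" "mdist Z" by simp
  have "thickening Z W e = (\<Union>w\<in>W. mball w e)"
    using assms by (auto simp: thickening_def commute subset_iff)
  then show ?thesis by (auto simp: mtopology_of_def)
qed

lemma sets_thickening: "A \<in> sets (mborel Z) \<Longrightarrow> thickening Z A e \<in> sets (mborel Z)"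
  using sets.sets_into_space by (intro openin_imp_sets_mborel openin_thickening) fastforce

lemma thickening_mono: "e \<le> e' \<Longrightarrow> thickening Z A e \<subseteq> thickening Z A e'"
  by (force simp: thickening_def)

section \<open>The Gromov--Hausdorff--Prokhorov distance\<close>

text \<open>A witness for \<open>GHP_dist\<close> with all infima removed: a single radius
  \<open>e\<close> serves the Hausdorff and the Prokhorov condition at once.\<close>

definition ghp_within ::
    "real \<Rightarrow> 'z metric \<Rightarrow> ('a \<Rightarrow> 'z) \<Rightarrow> ('b \<Rightarrow> 'z) \<Rightarrow> 'a mm_space \<Rightarrow> 'b mm_space \<Rightarrow> bool" where
  "ghp_within e Z i j M N \<longleftrightarrow> 0 < e \<and>
     isometric_embedding (mm_metric M) Z i \<and> isometric_embedding (mm_metric N) Z j \<and>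
     i ` mspace (mm_metric M) \<subseteq> thickening Z (j ` mspace (mm_metric N)) e \<and>
     j ` mspace (mm_metric N) \<subseteq> thickening Z (i ` mspace (mm_metric M)) e \<and>
     (\<forall>A\<in>sets (mborel Z).
       emeasure (distr (mm_measure M) (mborel Z) i) A
         \<le> emeasure (distr (mm_measure N) (mborel Z) j) (thickening Z A e) + ennreal e \<and>
       emeasure (distr (mm_measure N) (mborel Z) j) A
         \<le> emeasure (distr (mm_measure M) (mborel Z) i) (thickening Z A e) + ennreal e)"

lemma ghp_within_sym: "ghp_within e Z i j M N \<Longrightarrow> ghp_within e Z j i N M"
  by (auto simp: ghp_within_def)

lemma GHP_dist_le:
  fixes Z :: "'z metric"
  assumes "ghp_within e Z i j M N"
  shows "GHP_dist TYPE('z) M N \<le> ennreal e"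
proof -
  have "hausdorff_dist Z (i ` mspace (mm_metric M)) (j ` mspace (mm_metric N)) \<le> ennreal e"
    using assms unfolding hausdorff_dist_def ghp_within_def by (intro Inf_lower) auto
  moreover have "prokhorov_dist Z (distr (mm_measure M) (mborel Z) i)
      (distr (mm_measure N) (mborel Z) j) \<le> ennreal e"
    using assms unfolding prokhorov_dist_def ghp_within_def by (intro Inf_lower) auto
  ultimately show ?thesis
    using assms unfolding GHP_dist_def ghp_within_def
    by (intro Inf_lower2[where u = "max (hausdorff_dist Z (i ` mspace (mm_metric M)) (j ` mspace (mm_metric N)))
              (prokhorov_dist Z (distr (mm_measure M) (mborel Z) i)
                                (distr (mm_measure N) (mborel Z) j))"]) auto
qed

text \<open>A strict bound on an infimum yields an element below the bound. The Hausdorff and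
  Prokhorov radii found this way are merged into their maximum, because thickenings grow with the
  radius and both conditions survive enlarging it.\<close>

lemma GHP_dist_less_obtain:
  assumes "GHP_dist TYPE('z) M N < ennreal d"
  obtains e i j and Z :: "'z metric" where "e < d" "ghp_within e Z i j M N"
proof -
  let ?\<mu> = "\<lambda>Z i. distr (mm_measure M) (mborel Z) i" and ?\<nu> = "\<lambda>Z j. distr (mm_measure N) (mborel Z) j"
  let ?I = "\<lambda>i. i ` mspace (mm_metric M)" and ?J = "\<lambda>j. j ` mspace (mm_metric N)"
  obtain Z :: "'z metric" and i j where
    i: "isometric_embedding (mm_metric M) Z i" and j: "isometric_embedding (mm_metric N) Z j"
    and H: "hausdorff_dist Z (?I i) (?J j) < ennreal d"
    and P: "prokhorov_dist Z (?\<mu> Z i) (?\<nu> Z j) < ennreal d"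
    using assms unfolding GHP_dist_def Inf_less_iff by auto
  from H obtain e1 where e1: "0 < e1" "ennreal e1 < ennreal d"
    "?I i \<subseteq> thickening Z (?J j) e1" "?J j \<subseteq> thickening Z (?I i) e1"
    unfolding hausdorff_dist_def Inf_less_iff by auto
  from P obtain e2 where e2: "0 < e2" "ennreal e2 < ennreal d"
    "\<And>A. A \<in> sets (mborel Z) \<Longrightarrow>
       emeasure (?\<mu> Z i) A \<le> emeasure (?\<nu> Z j) (thickening Z A e2) + ennreal e2"
    "\<And>A. A \<in> sets (mborel Z) \<Longrightarrow>
       emeasure (?\<nu> Z j) A \<le> emeasure (?\<mu> Z i) (thickening Z A e2) + ennreal e2"
    unfolding prokhorov_dist_def Inf_less_iff by auto
  let ?e = "max e1 e2"
  have mono: "emeasure L (thickening Z A e2) + ennreal e2 \<le> emeasure L (thickening Z A ?e) + ennreal ?e"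
    if "A \<in> sets (mborel Z)" "sets L = sets (mborel Z)" for L A
    using that by (intro add_mono emeasure_mono thickening_mono ennreal_leI) (auto simp: sets_thickening)
  have "ghp_within ?e Z i j M N"
    unfolding ghp_within_def
  proof (intro conjI ballI)
    show "?I i \<subseteq> thickening Z (?J j) ?e" "?J j \<subseteq> thickening Z (?I i) ?e"
      using e1(3,4) thickening_mono[of e1 ?e] by force+
  next
    fix A assume A: "A \<in> sets (mborel Z)"
    show "emeasure (?\<mu> Z i) A \<le> emeasure (?\<nu> Z j) (thickening Z A ?e) + ennreal ?e"
      by (rule order_trans[OF e2(3)[OF A] mono[OF A]]) simp
    show "emeasure (?\<nu> Z j) A \<le> emeasure (?\<mu> Z i) (thickening Z A ?e) + ennreal ?e"
      by (rule order_trans[OF e2(4)[OF A] mono[OF A]]) simp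
  qed (use e1 i j in auto)
  moreover have "?e < d" using e1 e2 by (simp add: ennreal_less_iff)
  ultimately show thesis using that by blast
qed

section \<open>Interleavings of kernel linkages\<close>

lemma refines_trans: "S \<preceq> T \<Longrightarrow> T \<preceq> U \<Longrightarrow> S \<preceq> U"
  unfolding refines_def by (meson order_trans)

lemma clustering_pullback_mono:
  "S \<preceq> T \<Longrightarrow> clustering_pullback f Y S \<preceq> clustering_pullback f Y T"
  unfolding refines_def clustering_pullback_def ball_simps bex_simps
  by (meson Int_mono order_refl vimage_mono)

text \<open>Negating the third coordinate turns the condition \<open>k > 0\<close> into
  \<open>r $ 3 < 0\<close>. If the first two coordinates are positive, lowering the third alone
  reaches a parameter below \<open>r\<close>, so the extension is the top clustering
  \<open>{R}\<close> once \<open>r $ 3\<close> is nonnegative. If one of the first two is not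
  positive, no parameter lies below \<open>r\<close>.\<close>

lemma hc_ext_kernel_linkage:
  "hc_ext (hc_pullback p R (kernel_linkage K M)) r =
    (if 0 < r $ 1 \<and> 0 < r $ 2 \<and> r $ 3 < 0
     then clustering_pullback p R (single_linkage
       (submetric (mm_metric M) (dense_points K M (r $ 1) (- (r $ 3)))) (r $ 2))
     else if 0 < r $ 1 \<and> 0 < r $ 2 then {R} else {})"
proof -
  let ?H = "hc_pullback p R (kernel_linkage K M)"
  have neg: "hc_neg ?H r $ j = (if j = 3 then - (r $ j) else r $ j)" for r j
    by (simp add: hc_neg_def hc_pullback_def kernel_linkage_def)
  have "r \<in> hc_params' ?H \<longleftrightarrow> (\<forall>j. 0 < hc_neg ?H r $ j)" for r
    by (simp add: hc_params'_def hc_params_def hc_pullback_def kernel_linkage_def)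
  then have P: "r \<in> hc_params' ?H \<longleftrightarrow> 0 < r $ 1 \<and> 0 < r $ 2 \<and> r $ 3 < 0" for r
    unfolding neg forall_3 by simp
  have "(\<exists>q\<in>hc_params' ?H. q < r) \<longleftrightarrow> 0 < r $ 1 \<and> 0 < r $ 2"
  proof
    assume r: "0 < r $ 1 \<and> 0 < r $ 2"
    \<comment> \<open>Subtracting 1 makes the third coordinate strictly smaller than that of
      \<open>r\<close>; the minimum with -1 keeps it negative, hence admissible.\<close>
    let ?q = "\<chi> j. if j = 3 then min (r $ 3 - 1) (- 1) else r $ j"
    have "?q $ j \<le> r $ j" for j by auto
    moreover have "\<not> r $ 3 \<le> ?q $ 3" by auto
    ultimately have "?q < r" unfolding less_vec_def less_eq_vec_def by blast
    moreover have "?q \<in> hc_params' ?H" using r unfolding P by auto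
    ultimately show "\<exists>q\<in>hc_params' ?H. q < r" by blast
  next
    assume "\<exists>q\<in>hc_params' ?H. q < r"
    then obtain q where "0 < q $ 1" "0 < q $ 2" "q \<le> r" unfolding Bex_def P by auto
    then show "0 < r $ 1 \<and> 0 < r $ 2"
      unfolding less_eq_vec_def by (meson less_le_trans)
  qed
  then show ?thesis
    unfolding hc_ext_def P neg by (simp add: hc_pullback_def kernel_linkage_def hc_neg_def)
qed

text \<open>Since \<open>sl_rel\<close> is the least equivalence containing the close pairs, no
  chains have to be followed: it suffices that the pairs in \<open>A\<close> whose lifts to
  \<open>R\<close> are linked in \<open>B\<close> at \<open>t + \<eta>\<close> form an equivalence
  containing the pairs at distance at most \<open>t\<close>. Transitivity uses a lift of the middle
  point, which exists because \<open>p\<close> is onto.\<close>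

lemma single_linkage_pullback_refines:
  assumes p: "p ` R = mspace m" and q: "q ` R \<subseteq> mspace n" and "A \<subseteq> mspace m" "B \<subseteq> mspace n" "0 \<le> t"
    and AB: "\<And>z. z \<in> R \<Longrightarrow> p z \<in> A \<Longrightarrow> q z \<in> B"
    and le: "\<And>z z'. z \<in> R \<Longrightarrow> z' \<in> R \<Longrightarrow> mdist n (q z) (q z') \<le> mdist m (p z) (p z') + \<eta>"
  shows "clustering_pullback p R (single_linkage (submetric m A) t)
    \<preceq> clustering_pullback q R (single_linkage (submetric n B) (t + \<eta>))"
proof -
  have A: "mspace (submetric m A) = A" and B: "mspace (submetric n B) = B" 
    using assms by auto
  let ?F = "sl_rel (submetric n B) (t + \<eta>)"
  have F: "equiv B ?F" using equiv_sl_rel[of "submetric n B" "t + \<eta>"] unfolding B .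
  have F1: "(x, y) \<in> ?F" if "x \<in> B" "y \<in> B" "mdist n x y \<le> t + \<eta>" for x y
    using that unfolding sl_rel_def B by auto
  \<comment> \<open>Quantifying over all lifts is what finally places every element of a pulled back
    class into one class of the target.\<close>
  let ?E = "{(x, x'). x \<in> A \<and> x' \<in> A \<and>
      (\<forall>z\<in>R. \<forall>z'\<in>R. p z = x \<longrightarrow> p z' = x' \<longrightarrow> (q z, q z') \<in> ?F)}"
  have pairs: "(x, x') \<in> ?E" if "x \<in> A" "x' \<in> A" "mdist m x x' \<le> t" for x x'
  proof -
    have "(q z, q z') \<in> ?F" if "z \<in> R" "z' \<in> R" "p z = x" "p z' = x'" for z z'
      using le[OF that(1,2)] that \<open>x \<in> A\<close> \<open>x' \<in> A\<close> \<open>mdist m x x' \<le> t\<close> by (intro F1 AB) auto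
    then show ?thesis using \<open>x \<in> A\<close> \<open>x' \<in> A\<close> by blast
  qed
  have "equiv A ?E"
  proof (rule equivI)
    show "refl_on A ?E"
    proof (rule refl_onI)
      fix x assume "x \<in> A"
      moreover have "mdist m x x = 0" using \<open>x \<in> A\<close> assms(3) by (subst mdist_zero) auto
      \<comment> \<open>Two lifts of the same point may have different images under
        \<open>q\<close>, but these are at distance at most \<open>\<eta>\<close>, which is at most
        \<open>t + \<eta>\<close>.\<close>
      ultimately show "(x, x) \<in> ?E" using assms(5) by (intro pairs) auto
    qed
    show "sym ?E"
      using F unfolding sym_def equiv_def by blast
    show "trans ?E"
    proof (rule transI)
      fix x y w assume 1: "(x, y) \<in> ?E" and 2: "(y, w) \<in> ?E"
      then have "y \<in> p ` R" using p assms(3) by auto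
      then obtain z where "z \<in> R" "p z = y" by auto
      then have "(q a, q b) \<in> ?F" if "a \<in> R" "b \<in> R" "p a = x" "p b = w" for a b
      proof -
        have "(q a, q z) \<in> ?F" "(q z, q b) \<in> ?F"
          using that 1 2 \<open>z \<in> R\<close> \<open>p z = y\<close> by blast+
        then show ?thesis using F unfolding equiv_def by (meson transD)
      qed
      then show "(x, w) \<in> ?E" using 1 2 by blast
    qed
  qed blast
  then have sub: "sl_rel (submetric m A) t \<subseteq> ?E"
    using pairs unfolding sl_rel_def[of "submetric m A"] A mdist_submetric
    by (intro Inter_lower) auto
  show ?thesis
    unfolding refines_def clustering_pullback_def single_linkage_def A B
  proof
    fix C assume "C \<in> (\<lambda>C. p -` C \<inter> R) ` (A // sl_rel (submetric m A) t)"
    then obtain x where x: "x \<in> A" "C = p -` (sl_rel (submetric m A) t `` {x}) \<inter> R"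
      by (auto elim!: quotientE)
    obtain z where z: "z \<in> R" "p z = x" using x(1) p assms(3) by (metis imageE subsetD)
    have "C \<subseteq> q -` (?F `` {q z}) \<inter> R"
      using x(2) sub z by blast
    moreover have "?F `` {q z} \<in> B // ?F"
      using z x AB by (auto intro: quotientI)
    ultimately show "\<exists>D\<in>(\<lambda>C. q -` C \<inter> R) ` (B // ?F). C \<subseteq> D" by blast
  qed
qed

text \<open>Case distinction along the explicit form of the extension. If the left side is nonempty
  and the shift makes the third coordinate nonnegative, the right side is \<open>{R}\<close>, which
  every pullback refines; therefore \<open>dense\<close> concerns \<open>k > \<eta>\<close>
  only.\<close>

lemma hc_ext_kernel_linkage_refines:
  assumes p: "p ` R = mspace (mm_metric M)" and q: "q ` R \<subseteq> mspace (mm_metric N)" and "0 \<le> \<eta>"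
    and dense: "\<And>z s k. \<lbrakk>z \<in> R; 0 < s; \<eta> < k; p z \<in> dense_points K M s k\<rbrakk>
      \<Longrightarrow> q z \<in> dense_points K N (s + \<eta>) (k - \<eta>)"
    and le: "\<And>z z'. z \<in> R \<Longrightarrow> z' \<in> R \<Longrightarrow>
      mdist (mm_metric N) (q z) (q z') \<le> mdist (mm_metric M) (p z) (p z') + \<eta>"
  shows "hc_ext (hc_pullback p R (kernel_linkage K M)) r
    \<preceq> hc_ext (hc_pullback q R (kernel_linkage K N)) (r + (\<chi> j. \<eta>))"
proof -
  have *: "clustering_pullback p R (single_linkage
       (submetric (mm_metric M) (dense_points K M (r $ 1) (- (r $ 3)))) (r $ 2))
    \<preceq> clustering_pullback q R (single_linkage
       (submetric (mm_metric N) (dense_points K N (r $ 1 + \<eta>) (- (r $ 3) - \<eta>))) (r $ 2 + \<eta>))"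
    if "0 < r $ 1" "0 < r $ 2" "r $ 3 + \<eta> < 0"
    using that by (intro single_linkage_pullback_refines p q dense le) (auto simp: dense_points_def)
  have "clustering_pullback p R S \<preceq> {R}" for S
    by (auto simp: refines_def clustering_pullback_def)
  moreover have "{R} \<preceq> {R}" "{} \<preceq> {R}" "\<And>S. {} \<preceq> S" by (auto simp: refines_def)
  ultimately show ?thesis
    unfolding hc_ext_kernel_linkage using * assms(3) by auto
qed

section \<open>Prokhorov distance and integrals\<close>

text \<open>Tonelli for the indicator of the region under the graph of \<open>f\<close>: integrating
  over \<open>u\<close> first gives \<open>f x\<close>, integrating over \<open>x\<close> first
  gives the measure of a superlevel set.\<close>

lemma nn_integral_layer_cake:
  fixes f :: "'a \<Rightarrow> real"
  assumes "sigma_finite_measure M" and f[measurable]: "f \<in> borel_measurable M"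
    and nonneg: "\<And>x. x \<in> space M \<Longrightarrow> 0 \<le> f x"
  shows "(\<integral>\<^sup>+x. ennreal (f x) \<partial>M) =
    (\<integral>\<^sup>+u. indicator {0..} u * emeasure M {x \<in> space M. u < f x} \<partial>lborel)"
proof -
  interpret sigma_finite_measure M by fact
  interpret pair_sigma_finite M lborel ..
  let ?h = "\<lambda>x u. indicator {0..} u * indicator {p \<in> space (M \<Otimes>\<^sub>M lborel). snd p < f (fst p)} (x, u) :: ennreal"
  have [measurable]: "case_prod ?h \<in> borel_measurable (M \<Otimes>\<^sub>M lborel)"
    by measurable
  have "(\<integral>\<^sup>+x. ennreal (f x) \<partial>M) = (\<integral>\<^sup>+x. (\<integral>\<^sup>+u. ?h x u \<partial>lborel) \<partial>M)"
  proof (rule nn_integral_cong)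
    fix x assume x: "x \<in> space M"
    have "(\<integral>\<^sup>+u. ?h x u \<partial>lborel) = (\<integral>\<^sup>+u. indicator {0..<f x} u \<partial>lborel)"
      using x by (intro nn_integral_cong) (auto simp: space_pair_measure split: split_indicator)
    then show "ennreal (f x) = (\<integral>\<^sup>+u. ?h x u \<partial>lborel)"
      using nonneg[OF x] by simp
  qed
  also have "\<dots> = (\<integral>\<^sup>+u. (\<integral>\<^sup>+x. ?h x u \<partial>M) \<partial>lborel)"
    by (rule Fubini'[symmetric]) measurable
  also have "\<dots> = (\<integral>\<^sup>+u. indicator {0..} u * emeasure M {x \<in> space M. u < f x} \<partial>lborel)"
  proof (rule nn_integral_cong)
    fix u :: real
    have "(\<integral>\<^sup>+x. ?h x u \<partial>M) = (\<integral>\<^sup>+x. indicator {0..} u * indicator {x \<in> space M. u < f x} x \<partial>M)"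
      by (intro nn_integral_cong) (auto simp: space_pair_measure split: split_indicator)
    also have "\<dots> = indicator {0..} u * emeasure M {x \<in> space M. u < f x}"
      by (subst nn_integral_cmult) auto
    finally show "(\<integral>\<^sup>+x. ?h x u \<partial>M) = \<dots>" .
  qed
  finally show ?thesis .
qed

text \<open>By \<open>shift\<close>, the thickening of a superlevel set of \<open>f\<close> lies in
  the superlevel set of \<open>g\<close> at the same height \<open>u\<close>, so its measure exceeds
  that of the latter by at most \<open>e\<close>. For \<open>u \<ge> b\<close> the superlevel set of
  \<open>f\<close> is empty, so integrating over \<open>u\<close> costs only
  \<open>b * e\<close>.\<close>

lemma integral_le_prokhorov:
  fixes f g :: "'z \<Rightarrow> real"
  assumes "prob_space \<mu>" "prob_space \<nu>"
    and sets: "sets \<mu> = sets (mborel Z)" "sets \<nu> = sets (mborel Z)"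
    and close: "\<And>A. A \<in> sets (mborel Z) \<Longrightarrow>
      emeasure \<mu> A \<le> emeasure \<nu> (thickening Z A e) + ennreal e"
    and f: "integrable \<mu> f" and g: "integrable \<nu> g" and "0 < e"
    and bounds: "\<And>z. z \<in> mspace Z \<Longrightarrow> 0 \<le> f z \<and> f z \<le> b" "\<And>z. z \<in> mspace Z \<Longrightarrow> 0 \<le> g z"
    and shift: "\<And>w z. \<lbrakk>w \<in> mspace Z; z \<in> mspace Z; mdist Z z w < e\<rbrakk> \<Longrightarrow> f w \<le> g z"
  shows "(\<integral>z. f z \<partial>\<mu>) \<le> (\<integral>z. g z \<partial>\<nu>) + b * e"
proof -
  interpret \<mu>: prob_space \<mu> by fact
  interpret \<nu>: prob_space \<nu> by fact
  have space: "space \<mu> = mspace Z" "space \<nu> = mspace Z"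
    using sets[THEN sets_eq_imp_space_eq] by auto
  note [measurable] = borel_measurable_integrable[OF f] borel_measurable_integrable[OF g]
  obtain z0 where "z0 \<in> mspace Z" using \<mu>.not_empty space by auto
  then have b: "0 \<le> b" using bounds(1)[of z0] by auto
  let ?F = "\<lambda>u. {z \<in> mspace Z. u < f z}" and ?G = "\<lambda>u. {z \<in> mspace Z. u < g z}"
  have F: "?F u \<in> sets (mborel Z)" and G: "?G u \<in> sets \<nu>" for u
    using sets borel_measurable_integrable[OF f] borel_measurable_integrable[OF g]
    unfolding borel_measurable_iff_greater space by auto
  have "(\<integral>\<^sup>+z. f z \<partial>\<mu>) = (\<integral>\<^sup>+u. indicator {0..} u * emeasure \<mu> (?F u) \<partial>lborel)"
    using bounds by (subst nn_integral_layer_cake) (auto simp: space \<mu>.sigma_finite_measure_axioms)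
  also have "\<dots> \<le> (\<integral>\<^sup>+u. indicator {0..} u * emeasure \<nu> (?G u) + ennreal e * indicator {0..<b} u \<partial>lborel)"
  proof (rule nn_integral_mono)
    fix u :: real
    have "emeasure \<mu> (?F u) \<le> emeasure \<nu> (?G u) + e"
    proof -
      have "thickening Z (?F u) e \<subseteq> ?G u"
        using shift by (force simp: thickening_def)
      then show ?thesis
        using close[OF F] G emeasure_mono[of "thickening Z (?F u) e" "?G u" \<nu>]
        by (meson add_right_mono order_trans)
    qed
    moreover have "emeasure \<mu> (?F u) = 0" if "b \<le> u"
    proof -
      have "?F u = {}" using that bounds(1) by force
      then show ?thesis by (simp only: emeasure_empty)
    qed
    ultimately show "indicator {0..} u * emeasure \<mu> (?F u)
        \<le> indicator {0..} u * emeasure \<nu> (?G u) + ennreal e * indicator {0..<b} u"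
      by (cases "b \<le> u") (auto split: split_indicator)
  qed
  also have "\<dots> = (\<integral>\<^sup>+u. indicator {0..} u * emeasure \<nu> (?G u) \<partial>lborel) + ennreal e * ennreal b"
  proof -
    \<comment> \<open>Splitting the integral of the sum requires the measure of \<open>?G u\<close>
      to depend measurably on \<open>u\<close>; it is the measure of a section of a measurable set
      in the product.\<close>
    have "{p \<in> space (lborel \<Otimes>\<^sub>M \<nu>). fst p < g (snd p)} \<in> sets (lborel \<Otimes>\<^sub>M \<nu>)"
      by measurable
    from \<nu>.measurable_emeasure_Pair[OF this]
    have "(\<lambda>u. emeasure \<nu> (Pair u -` {p \<in> space (lborel \<Otimes>\<^sub>M \<nu>). fst p < g (snd p)}))
        \<in> borel_measurable lborel" .
    moreover have "Pair u -` {p \<in> space (lborel \<Otimes>\<^sub>M \<nu>). fst p < g (snd p)} = ?G u" for u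
      by (auto simp: space_pair_measure space)
    ultimately have "(\<lambda>u. emeasure \<nu> (?G u)) \<in> borel_measurable lborel"
      by simp
    then show ?thesis
      using b assms(8) by (subst nn_integral_add) (auto simp: nn_integral_cmult ennreal_mult)
  qed
  also have "(\<integral>\<^sup>+u. indicator {0..} u * emeasure \<nu> (?G u) \<partial>lborel) = (\<integral>\<^sup>+z. g z \<partial>\<nu>)"
    using bounds by (subst nn_integral_layer_cake) (auto simp: space \<nu>.sigma_finite_measure_axioms)
  finally have "(\<integral>\<^sup>+z. f z \<partial>\<mu>) \<le> (\<integral>\<^sup>+z. g z \<partial>\<nu>) + ennreal (e * b)"
    using b assms(8) by (simp add: ennreal_mult)
  moreover have nonneg: "0 \<le> (\<integral>z. g z \<partial>\<nu>)"
    using bounds by (intro integral_nonneg_AE AE_I2) (auto simp: space)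
  moreover have "(\<integral>\<^sup>+z. f z \<partial>\<mu>) = ennreal (\<integral>z. f z \<partial>\<mu>)"
    using bounds by (intro nn_integral_eq_integral f AE_I2) (auto simp: space)
  moreover have "(\<integral>\<^sup>+z. g z \<partial>\<nu>) = ennreal (\<integral>z. g z \<partial>\<nu>)"
    using bounds by (intro nn_integral_eq_integral g AE_I2) (auto simp: space)
  ultimately have "ennreal (\<integral>z. f z \<partial>\<mu>) \<le> ennreal ((\<integral>z. g z \<partial>\<nu>) + b * e)"
    using b assms(8) by (simp add: mult.commute)
  then show ?thesis
    using b assms(8) nonneg by (subst (asm) ennreal_le_iff) auto
qed

section \<open>Stability of dense points\<close>

lemma metric_prob_space_distr:
  assumes "metric_prob_space M" "isometric_embedding (mm_metric M) Z i"
  shows "metric_prob_space \<lparr>mm_metric = Z, mm_measure = distr (mm_measure M) (mborel Z) i\<rparr>"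
  using assms measurable_isometric_embedding[OF assms]
  by (auto simp: metric_prob_space_def intro: prob_space.prob_space_distr)

lemma integral_kernel_distr:
  assumes "kernel_function K" "metric_prob_space M" "isometric_embedding (mm_metric M) Z i"
    and x: "x \<in> mspace (mm_metric M)" and "0 < s"
  shows "(\<integral>z. K (mdist Z (i x) z / s) \<partial>distr (mm_measure M) (mborel Z) i)
    = (\<integral>x'. K (mdist (mm_metric M) x x' / s) \<partial>mm_measure M)"
proof -
  have ix: "i x \<in> mspace Z" using assms by (auto simp: isometric_embedding_def)
  have "(\<lambda>z. K (mdist Z (i x) z / s)) \<in> borel_measurable (mborel Z)"
    using borel_measurable_integrable[OF integrable_kernel[OF assms(1)
        metric_prob_space_distr[OF assms(2,3)] _ assms(5), of "i x"]] ix
    by simp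
  then have "(\<integral>z. K (mdist Z (i x) z / s) \<partial>distr (mm_measure M) (mborel Z) i)
      = (\<integral>x'. K (mdist Z (i x) (i x') / s) \<partial>mm_measure M)"
    using measurable_isometric_embedding[OF assms(2,3)] by (intro integral_distr)
  also have "\<dots> = (\<integral>x'. K (mdist (mm_metric M) x x' / s) \<partial>mm_measure M)"
    using assms(3) x by (intro Bochner_Integration.integral_cong)
      (auto simp: isometric_embedding_def space_mm_measure[OF assms(2)])
  finally show ?thesis .
qed

text \<open>
  The parameter \<open>c\<close> absorbs the drop of \<open>K\<close> near \<open>0\<close>: enlarging the scale by \<open>\<eta>\<close> compensates
  the displacement \<open>2 * e\<close> of the distances only away from \<open>0\<close>.
\<close>

definition kernel_shift :: "(real \<Rightarrow> real) \<Rightarrow> real \<Rightarrow> real \<Rightarrow> real \<Rightarrow> bool" where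
  "kernel_shift K e \<eta> c \<longleftrightarrow> 0 \<le> c \<and> 2 * e \<le> \<eta> \<and> K 0 * e + c \<le> \<eta> \<and>
     (\<forall>s>0. \<forall>r\<ge>0. \<forall>r'\<ge>0. r' * (s + \<eta>) < r * s + 2 * e \<longrightarrow> K r \<le> K r' + c)"

text \<open>The kernels centred at \<open>i x\<close> and \<open>j y\<close> are compared by
  \<open>integral_le_prokhorov\<close>, with \<open>K 0\<close> as upper bound. The total loss
  \<open>K 0 * e + c\<close> is at most \<open>\<eta>\<close>, which lowers the threshold from
  \<open>k\<close> to \<open>k - \<eta>\<close>.\<close>

lemma dense_points_ghp_within:
  assumes K: "kernel_function K" and M: "metric_prob_space M" and N: "metric_prob_space N"
    and ghp: "ghp_within e Z i j M N" and shift: "kernel_shift K e \<eta> c"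
    and "y \<in> mspace (mm_metric N)" and xy: "mdist Z (i x) (j y) < e"
    and x: "x \<in> dense_points K M s k" and "0 < s"
  shows "y \<in> dense_points K N (s + \<eta>) (k - \<eta>)"
proof -
  let ?\<mu> = "distr (mm_measure M) (mborel Z) i" and ?\<nu> = "distr (mm_measure N) (mborel Z) j"
  have i: "isometric_embedding (mm_metric M) Z i" and j: "isometric_embedding (mm_metric N) Z j"
    and "0 < e" using ghp by (auto simp: ghp_within_def)
  have xM: "x \<in> mspace (mm_metric M)" using x by (simp add: dense_points_def)
  have ix: "i x \<in> mspace Z" and jy: "j y \<in> mspace Z"
    using i j xM assms(6) by (auto simp: isometric_embedding_def)
  have \<eta>: "0 < \<eta>" using shift \<open>0 < e\<close> by (simp add: kernel_shift_def)
  note \<mu> = metric_prob_space_distr[OF M i] and \<nu> = metric_prob_space_distr[OF N j]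
  have "prob_space ?\<nu>" using \<nu> by (simp add: metric_prob_space_def)
  interpret \<nu>: prob_space ?\<nu> by fact
  have f: "integrable ?\<mu> (\<lambda>z. K (mdist Z (i x) z / s))"
    using integrable_kernel[OF K \<mu>, of "i x" s] ix \<open>0 < s\<close> by simp
  have g: "integrable ?\<nu> (\<lambda>z. K (mdist Z (j y) z / (s + \<eta>)))"
    using integrable_kernel[OF K \<nu>, of "j y" "s + \<eta>"] jy \<open>0 < s\<close> \<eta> by simp
  have K0: "0 \<le> K r" "K r \<le> K 0" if "0 \<le> r" for r
    using K that by (auto simp: kernel_function_def monotone_on_def)
  have "k \<le> (\<integral>z. K (mdist Z (i x) z / s) \<partial>?\<mu>)"
    using x by (simp add: integral_kernel_distr[OF K M i xM \<open>0 < s\<close>] dense_points_def)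
  also have "\<dots> \<le> (\<integral>z. K (mdist Z (j y) z / (s + \<eta>)) + c \<partial>?\<nu>) + K 0 * e"
  proof (rule integral_le_prokhorov)
    fix w z assume wz: "w \<in> mspace Z" "z \<in> mspace Z" "mdist Z z w < e"
    have "mdist Z (j y) z \<le> mdist Z (j y) (i x) + mdist Z (i x) z"
      "mdist Z (i x) z \<le> mdist Z (i x) w + mdist Z w z"
      using ix jy wz by (auto intro: mdist_triangle)
    \<comment> \<open>One \<open>e\<close> comes from moving the centre from \<open>i x\<close> to
      \<open>j y\<close>, the other from the thickening that moves \<open>w\<close> to
      \<open>z\<close>.\<close>
    then have "mdist Z (j y) z < mdist Z (i x) w + 2 * e"
      using xy wz by (simp add: mdist_commute)
    then have "mdist Z (j y) z / (s + \<eta>) * (s + \<eta>) < mdist Z (i x) w / s * s + 2 * e"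
      using \<open>0 < s\<close> \<eta> by simp
    moreover have "0 \<le> mdist Z (j y) z / (s + \<eta>)" "0 \<le> mdist Z (i x) w / s"
      using \<open>0 < s\<close> \<eta> by auto
    ultimately show "K (mdist Z (i x) w / s) \<le> K (mdist Z (j y) z / (s + \<eta>)) + c"
      using shift \<open>0 < s\<close> unfolding kernel_shift_def by blast
  next
    fix A assume "A \<in> sets (mborel Z)"
    then show "emeasure ?\<mu> A \<le> emeasure ?\<nu> (thickening Z A e) + ennreal e"
      using ghp unfolding ghp_within_def by blast
  qed (use f g \<open>0 < e\<close> \<mu> \<nu> K0 \<open>0 < s\<close> \<eta> shift in
      \<open>auto simp: metric_prob_space_def kernel_shift_def intro!: add_nonneg_nonneg\<close>)
  also have "(\<integral>z. K (mdist Z (j y) z / (s + \<eta>)) + c \<partial>?\<nu>)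
      = (\<integral>z. K (mdist Z (j y) z / (s + \<eta>)) \<partial>?\<nu>) + c"
    using g by (simp add: \<nu>.prob_space[simplified])
  also have "(\<integral>z. K (mdist Z (j y) z / (s + \<eta>)) \<partial>?\<nu>)
      = (\<integral>y'. K (mdist (mm_metric N) y y' / (s + \<eta>)) \<partial>mm_measure N)"
    using \<open>0 < s\<close> \<eta> by (intro integral_kernel_distr K N j assms(6)) auto
  finally show ?thesis
    using shift assms(6) by (simp add: dense_points_def kernel_shift_def)
qed

text \<open>The Hausdorff part of \<open>ghp\<close> makes both projections of \<open>R\<close>
  surjective, and the triangle inequality bounds the distortion of \<open>R\<close> by
  \<open>2 * e \<le> \<eta>\<close>. The Prokhorov part enters through the densities. As
  \<open>ghp_within\<close> is symmetric, the second refinement repeats the first with the roles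
  exchanged.\<close>

lemma CI_dist_kernel_linkage_le:
  assumes K: "kernel_function K" and M: "metric_prob_space M" and N: "metric_prob_space N"
    and ghp: "ghp_within e Z i j M N" and shift: "kernel_shift K e \<eta> c"
  shows "CI_dist (kernel_linkage K M) (kernel_linkage K N) \<le> ennreal \<eta>"
proof -
  define R where "R = {(x, y). x \<in> mspace (mm_metric M) \<and> y \<in> mspace (mm_metric N) \<and>
    mdist Z (i x) (j y) < e}"
  have i: "isometric_embedding (mm_metric M) Z i" and j: "isometric_embedding (mm_metric N) Z j"
    and "0 < e" using ghp by (auto simp: ghp_within_def)
  have \<eta>: "0 \<le> \<eta>" "2 * e \<le> \<eta>" using shift \<open>0 < e\<close> by (auto simp: kernel_shift_def)
  have inZ: "i x \<in> mspace Z" "j y \<in> mspace Z"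
    if "x \<in> mspace (mm_metric M)" "y \<in> mspace (mm_metric N)" for x y
    using i j that by (auto simp: isometric_embedding_def)
  have fst: "fst ` R = mspace (mm_metric M)"
  proof
    show "mspace (mm_metric M) \<subseteq> fst ` R"
    proof
      fix x assume x: "x \<in> mspace (mm_metric M)"
      with ghp have "i x \<in> thickening Z (j ` mspace (mm_metric N)) e"
        unfolding ghp_within_def by blast
      then obtain y where "y \<in> mspace (mm_metric N)" "mdist Z (i x) (j y) < e"
        by (auto simp: thickening_def)
      with x have "(x, y) \<in> R" by (simp add: R_def)
      then show "x \<in> fst ` R" by force
    qed
  qed (auto simp: R_def)
  have snd: "snd ` R = mspace (mm_metric N)"
  proof
    show "mspace (mm_metric N) \<subseteq> snd ` R"
    proof
      fix y assume y: "y \<in> mspace (mm_metric N)"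
      with ghp have "j y \<in> thickening Z (i ` mspace (mm_metric M)) e"
        unfolding ghp_within_def by blast
      then obtain x where "x \<in> mspace (mm_metric M)" "mdist Z (j y) (i x) < e"
        by (auto simp: thickening_def)
      with y have "(x, y) \<in> R" by (simp add: R_def mdist_commute)
      then show "y \<in> snd ` R" by force
    qed
  qed (auto simp: R_def)
  have dist: "\<bar>mdist (mm_metric M) (fst z) (fst z') - mdist (mm_metric N) (snd z) (snd z')\<bar> \<le> \<eta>"
    if "z \<in> R" "z' \<in> R" for z z'
  proof -
    obtain x y x' y' where z: "z = (x, y)" "z' = (x', y')" by (cases z, cases z')
    have xy: "x \<in> mspace (mm_metric M)" "y \<in> mspace (mm_metric N)" "mdist Z (i x) (j y) < e"
      "x' \<in> mspace (mm_metric M)" "y' \<in> mspace (mm_metric N)" "mdist Z (i x') (j y') < e"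
      using that by (auto simp: R_def z)
    note Z = inZ[OF xy(1,2)] inZ[OF xy(4,5)]
    have "mdist Z (i x) (i x') \<le> mdist Z (i x) (j y) + mdist Z (j y) (i x')"
      "mdist Z (j y) (i x') \<le> mdist Z (j y) (j y') + mdist Z (j y') (i x')"
      "mdist Z (j y) (j y') \<le> mdist Z (j y) (i x) + mdist Z (i x) (j y')"
      "mdist Z (i x) (j y') \<le> mdist Z (i x) (i x') + mdist Z (i x') (j y')"
      using Z by (auto intro: mdist_triangle)
    moreover have "mdist Z (i x) (i x') = mdist (mm_metric M) x x'"
      "mdist Z (j y) (j y') = mdist (mm_metric N) y y'"
      using i j xy by (auto simp: isometric_embedding_def)
    ultimately show ?thesis
      using xy \<eta> mdist_commute[of Z "j y" "i x"] mdist_commute[of Z "j y'" "i x'"]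
      unfolding z fst_conv snd_conv by linarith
  qed
  have "interleaved_wrt R (\<chi> j. \<eta>) (kernel_linkage K M) (kernel_linkage K N)"
    unfolding interleaved_wrt_def interleaved_def
  proof (intro conjI allI)
    fix r
    show "hc_ext (hc_pullback fst R (kernel_linkage K M)) r
        \<preceq> hc_ext (hc_pullback snd R (kernel_linkage K N)) (r + (\<chi> j. \<eta>))"
    proof (rule hc_ext_kernel_linkage_refines)
      fix z s k assume z: "z \<in> R" "0 < s" "fst z \<in> dense_points K M s k"
      then show "snd z \<in> dense_points K N (s + \<eta>) (k - \<eta>)"
        by (intro dense_points_ghp_within[OF K M N ghp shift]) (auto simp: R_def)
    next
      fix z z' assume "z \<in> R" "z' \<in> R"
      from dist[OF this] show "mdist (mm_metric N) (snd z) (snd z')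
          \<le> mdist (mm_metric M) (fst z) (fst z') + \<eta>" by linarith
    qed (simp_all add: fst snd \<eta>)
    show "hc_ext (hc_pullback snd R (kernel_linkage K N)) r
        \<preceq> hc_ext (hc_pullback fst R (kernel_linkage K M)) (r + (\<chi> j. \<eta>))"
    proof (rule hc_ext_kernel_linkage_refines)
      fix z s k assume z: "z \<in> R" "0 < s" "snd z \<in> dense_points K N s k"
      then show "fst z \<in> dense_points K M (s + \<eta>) (k - \<eta>)"
        by (intro dense_points_ghp_within[OF K N M ghp_within_sym[OF ghp] shift])
          (auto simp: R_def mdist_commute)
    next
      fix z z' assume "z \<in> R" "z' \<in> R"
      from dist[OF this] show "mdist (mm_metric M) (fst z) (fst z')
          \<le> mdist (mm_metric N) (snd z) (snd z') + \<eta>" by linarith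
    qed (simp_all add: fst snd \<eta>)
  qed (simp add: hc_pullback_def)
  moreover have "correspondence (mspace (mm_metric M)) (mspace (mm_metric N)) R"
    using fst snd by (auto simp: correspondence_def R_def)
  ultimately show ?thesis
    unfolding CI_dist_def using \<eta> by (intro Inf_lower) (auto simp: kernel_linkage_def)
qed

text \<open>If \<open>r < 1\<close>, then \<open>r * s + 2 * e < s + 2 * e\<close>, which forces
  \<open>r' < 1\<close>; so the value 1 is never lost and \<open>c = 0\<close> suffices. As
  \<open>K 0 = 1\<close>, the binding condition is \<open>2 * e \<le> \<eta>\<close>, the source of
  the Lipschitz constant 2.\<close>

lemma kernel_shift_uniform:
  assumes "\<forall>r\<ge>0. K r = uniform_kernel r" "0 < e"
  shows "kernel_shift K e (2 * e) 0"
proof -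
  have "K r \<le> K r'" if "0 < s" "0 \<le> r" "0 \<le> r'" "r' * (s + 2 * e) < r * s + 2 * e" for s r r'
  proof (cases "r < 1")
    case True
    then have "r * s < s" using that by simp
    then have "r * s + 2 * e < 1 * (s + 2 * e)" by simp
    with that(4) have "r' * (s + 2 * e) < 1 * (s + 2 * e)" by (rule less_trans)
    then have "r' < 1" using assms(2) that by (simp only: mult_less_cancel_right)
    then show ?thesis using that assms(1) by (simp add: uniform_kernel_def)
  next
    case False
    then show ?thesis using that assms(1) by (simp add: uniform_kernel_def)
  qed
  moreover have "K 0 = 1" using assms(1) by (simp add: uniform_kernel_def)
  ultimately show ?thesis using assms(2) unfolding kernel_shift_def by simp
qed

text \<open>Right continuity at 0 gives \<open>\<rho>\<close> with
  \<open>K 0 - K \<rho> \<le> \<eta> / 2\<close>, and this drop is taken as \<open>c\<close>. For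
  \<open>r \<ge> \<rho>\<close> the larger scale gains \<open>r * \<eta> \<ge> 2 * e\<close>, which
  absorbs the displacement. For smaller \<open>r\<close>, also \<open>r' < \<rho>\<close>, and
  \<open>K\<close> drops by at most \<open>c\<close> there.\<close>

lemma kernel_shift_exists:
  assumes K: "kernel_function K" and \<eta>: "0 < \<eta>"
  obtains d c where "0 < d" "\<And>e. 0 < e \<Longrightarrow> e < d \<Longrightarrow> kernel_shift K e \<eta> c"
proof -
  have "continuous (at_right 0) K" and K0: "0 \<le> K 0"
    and mono: "\<And>r r'. 0 \<le> r \<Longrightarrow> r \<le> r' \<Longrightarrow> K r' \<le> K r"
    using K by (auto simp: kernel_function_def monotone_on_def)
  then have "(K \<longlongrightarrow> K 0) (at_right 0)" by (simp add: continuous_within)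
  then have "eventually (\<lambda>r. dist (K r) (K 0) < \<eta> / 2) (at_right 0)"
    using \<eta> by (intro tendstoD) auto
  then obtain b where b: "0 < b" "\<And>r. 0 < r \<Longrightarrow> r < b \<Longrightarrow> dist (K r) (K 0) < \<eta> / 2"
    unfolding eventually_at_right_field by auto
  define \<rho> where "\<rho> = b / 2"
  have \<rho>: "0 < \<rho>" and c: "0 \<le> K 0 - K \<rho>" "K 0 - K \<rho> \<le> \<eta> / 2"
    using b mono[of 0 \<rho>] b(2)[of \<rho>] by (auto simp: \<rho>_def dist_real_def)
  \<comment> \<open>The three bounds yield \<open>2 * e \<le> \<eta>\<close>,
    \<open>2 * e \<le> \<rho> * \<eta>\<close> and \<open>K 0 * e \<le> \<eta> / 2\<close>; adding 1
    to \<open>K 0\<close> keeps the denominator positive.\<close>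
  define d where "d = min (\<eta> / 2) (min (\<rho> * \<eta> / 2) (\<eta> / (2 * (K 0 + 1))))"
  show thesis
  proof
    show "0 < d" using \<eta> \<rho> K0 by (simp add: d_def)
  next
    fix e assume e: "0 < e" "e < d"
    have e1: "2 * e \<le> \<eta>" "2 * e \<le> \<rho> * \<eta>" and "e \<le> \<eta> / (2 * (K 0 + 1))"
      using e by (auto simp: d_def)
    then have "e * (2 * (K 0 + 1)) \<le> \<eta>" using K0 by (simp add: pos_le_divide_eq)
    then have e2: "K 0 * e \<le> \<eta> / 2" using e by (simp add: algebra_simps)
    have "K r \<le> K r' + (K 0 - K \<rho>)"
      if "0 < s" "0 \<le> r" "0 \<le> r'" "r' * (s + \<eta>) < r * s + 2 * e" for s r r'
    proof -
      \<comment> \<open>Replacing \<open>r\<close> by \<open>max r \<rho>\<close> treats small and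
        large \<open>r\<close> at once: in either case \<open>r'\<close> lies below that
        maximum.\<close>
      have "r * s \<le> max r \<rho> * s" "\<rho> * \<eta> \<le> max r \<rho> * \<eta>" using that \<eta> by auto
      then have "r' * (s + \<eta>) < max r \<rho> * (s + \<eta>)"
        using that(4) e1(2) distrib_left[of "max r \<rho>" s \<eta>] by linarith
      then have "r' < max r \<rho>" using that \<eta> by (simp only: mult_less_cancel_right)
      then have "K (max r \<rho>) \<le> K r'" using that by (intro mono) auto
      then show ?thesis using mono[of 0 r] that c by (cases "r \<le> \<rho>") (auto simp: max_def)
    qed
    then show "kernel_shift K e \<eta> (K 0 - K \<rho>)"
      using e1 e2 c unfolding kernel_shift_def by auto
  qed
qed

section \<open>Transfer to the real numbers\<close>

text \<open>Induction over the generated sigma-algebra: relatively open sets are traces of open sets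
  on \<open>C\<close>, and complements are taken in \<open>C\<close>, which is itself Borel.\<close>

lemma sets_mborel_submetric:
  assumes C: "C \<in> sets (mborel Z)" and B: "B \<in> sets (mborel (submetric Z C))"
  shows "B \<in> sets (mborel Z)"
proof -
  have "C \<subseteq> mspace Z" using sets.sets_into_space[OF C] by simp
  then have CZ: "C \<inter> mspace Z = C" by auto
  have "B \<in> sigma_sets C {U. openin (subtopology (mtopology_of Z) C) U}"
    using B by (simp add: sets_mborel CZ mtopology_of_submetric)
  then show ?thesis
  proof (induction B)
    case (Basic a)
    then show ?case using C by (auto simp: openin_subtopology intro: openin_imp_sets_mborel)
  next
    case (Union a)
    then show ?case by auto
  qed (use C in auto)
qed

text \<open>A compact set is totally bounded, so it has a countable dense subset, and a point is
  determined by which balls with centre there and radius \<open>1 / (n + 1)\<close> contain it. This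
  encodes points as sets of naturals, of which there are as many as reals. No continuity is claimed,
  since the metric is carried over separately.\<close>

lemma ex_inj_on_real_compactin:
  assumes C: "compactin (mtopology_of Z) C"
  shows "\<exists>g :: 'z \<Rightarrow> real. inj_on g (C :: 'z set)"
proof -
  interpret Metric_space "mspace Z" "mdist Z" by simp
  have CZ: "C \<subseteq> mspace Z" using compactin_subset_topspace[OF C] by simp
  have tb: "mtotally_bounded C"
    using C compactin_imp_mtotally_bounded by (simp add: mtopology_of_def)
  have "\<exists>N. finite N \<and> N \<subseteq> C \<and> C \<subseteq> (\<Union>x\<in>N. mball x (inverse (Suc n)))" for n
    using tb unfolding mtotally_bounded_def by simp
  then obtain N where N: "\<And>n. finite (N n)" "\<And>n. N n \<subseteq> C"
    "\<And>n. C \<subseteq> (\<Union>x\<in>N n. mball x (inverse (Suc n)))" by metis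
  define D where "D = (\<Union>n. N n)"
  have D: "countable D" unfolding D_def using N by (auto intro: countable_finite)
  define F where
    "F z = {prod_encode (m, n) | m n. mdist Z z (from_nat_into D m) < inverse (Suc n)}" for z
  have "inj_on F C"
  proof (rule inj_onI, rule ccontr)
    fix z z' assume z: "z \<in> C" "z' \<in> C" "F z = F z'" "z \<noteq> z'"
    then have "0 < mdist Z z z' / 2" using CZ by (simp add: subset_iff)
    \<comment> \<open>A ball of radius less than half the distance cannot contain both points, so
      its code separates them.\<close>
    then obtain n where n: "inverse (Suc n) < mdist Z z z' / 2"
      using reals_Archimedean by blast
    obtain x where x: "x \<in> N n" "mdist Z z x < inverse (Suc n)"
      using N(3)[of n] z(1) by (auto simp: commute)
    have "x \<in> D" using x by (auto simp: D_def)
    then obtain m where m: "x = from_nat_into D m"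
      using from_nat_into_surj[OF D] by metis
    have "prod_encode (m, n) \<in> F w \<longleftrightarrow> mdist Z w x < inverse (Suc n)" for w
      unfolding m F_def by auto
    with x(2) z(3) have "mdist Z z' x < inverse (Suc n)" by blast
    moreover have "mdist Z z z' \<le> mdist Z z x + mdist Z x z'"
      using z x N(2)[of n] CZ by (intro mdist_triangle) auto
    ultimately show False using x n commute[of z' x] by linarith
  qed
  moreover obtain h :: "nat set \<Rightarrow> real" where "bij h"
    using nat_sets_eqpoll_reals unfolding eqpoll_def by auto
  ultimately have "inj_on (h \<circ> F) C"
    by (intro comp_inj_on) (auto simp: bij_def intro: inj_on_subset)
  then show ?thesis by blast
qed

section \<open>Invariance under isomorphisms of metric probability spaces\<close>

definition mm_iso :: "('a \<Rightarrow> 'b) \<Rightarrow> 'a mm_space \<Rightarrow> 'b mm_space \<Rightarrow> bool" where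
  "mm_iso \<phi> M M' \<longleftrightarrow> isometric_embedding (mm_metric M) (mm_metric M') \<phi> \<and>
     \<phi> ` mspace (mm_metric M) = mspace (mm_metric M') \<and>
     mm_measure M' = distr (mm_measure M) (mborel (mm_metric M')) \<phi>"

lemma dense_points_mm_iso:
  assumes "kernel_function K" "metric_prob_space M" and iso: "mm_iso \<phi> M M'"
    and "x \<in> mspace (mm_metric M)" "0 < s"
  shows "\<phi> x \<in> dense_points K M' s k \<longleftrightarrow> x \<in> dense_points K M s k"
  using integral_kernel_distr[OF assms(1,2) _ assms(4,5), of "mm_metric M'" \<phi>] assms(4) iso
  by (auto simp: dense_points_def mm_iso_def)

text \<open>Pulling back along \<open>p'\<close> and then \<open>\<Phi>\<close> is pulling back
  along \<open>\<phi>\<close> after \<open>p\<close>. As \<open>\<phi>\<close> preserves distances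
  and densities, \<open>hc_ext_kernel_linkage_refines\<close> applies with shift 0 in both
  directions.\<close>

lemma hc_ext_kernel_linkage_mm_iso:
  fixes p :: "'c \<Rightarrow> 'a"
  assumes K: "kernel_function K" and M: "metric_prob_space M" and iso: "mm_iso \<phi> M M'"
    and p: "p ` R = mspace (mm_metric M)"
    and \<Phi>: "\<And>z. z \<in> R \<Longrightarrow> \<Phi> z \<in> R'" "\<And>z. z \<in> R \<Longrightarrow> p' (\<Phi> z) = \<phi> (p z)"
  shows "hc_ext (hc_pullback p R (kernel_linkage K M)) r
      \<preceq> clustering_pullback \<Phi> R (hc_ext (hc_pullback p' R' (kernel_linkage K M')) r)"
    and "clustering_pullback \<Phi> R (hc_ext (hc_pullback p' R' (kernel_linkage K M')) r)
      \<preceq> hc_ext (hc_pullback p R (kernel_linkage K M)) r"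
proof -
  have R: "\<Phi> -` R' \<inter> R = R" using \<Phi>(1) by auto
  have "\<Phi> -` (p' -` C \<inter> R') \<inter> R = (\<lambda>z. \<phi> (p z)) -` C \<inter> R" for C
    using \<Phi> by auto
  then have "clustering_pullback \<Phi> R (clustering_pullback p' R' S)
      = clustering_pullback (\<lambda>z. \<phi> (p z)) R S" for S
    by (simp add: clustering_pullback_def image_image)
  moreover have "clustering_pullback \<Phi> R {R'} = {R}" "clustering_pullback \<Phi> R {} = {}"
    using R by (simp_all add: clustering_pullback_def)
  ultimately have eq: "clustering_pullback \<Phi> R (hc_ext (hc_pullback p' R' (kernel_linkage K M')) r)
      = hc_ext (hc_pullback (\<lambda>z. \<phi> (p z)) R (kernel_linkage K M')) r"
    unfolding hc_ext_kernel_linkage by simp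
  have zero: "r + (\<chi> j. 0) = r" by (simp add: vec_eq_iff)
  have pR: "p z \<in> mspace (mm_metric M)" if "z \<in> R" for z using that p by blast
  have \<phi>: "(\<lambda>z. \<phi> (p z)) ` R = mspace (mm_metric M')"
    using iso p unfolding mm_iso_def by (metis image_image)
  have dist: "mdist (mm_metric M') (\<phi> (p z)) (\<phi> (p z')) = mdist (mm_metric M) (p z) (p z')"
    if "z \<in> R" "z' \<in> R" for z z'
    using iso pR[OF that(1)] pR[OF that(2)] by (simp add: mm_iso_def isometric_embedding_def)
  note dense = dense_points_mm_iso[OF K M iso pR]
  show "hc_ext (hc_pullback p R (kernel_linkage K M)) r
      \<preceq> clustering_pullback \<Phi> R (hc_ext (hc_pullback p' R' (kernel_linkage K M')) r)"
    unfolding eq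
    by (rule hc_ext_kernel_linkage_refines[where \<eta> = 0 and r = r, unfolded zero])
      (simp_all add: p \<phi> dense dist)
  show "clustering_pullback \<Phi> R (hc_ext (hc_pullback p' R' (kernel_linkage K M')) r)
      \<preceq> hc_ext (hc_pullback p R (kernel_linkage K M)) r"
    unfolding eq
    by (rule hc_ext_kernel_linkage_refines[where \<eta> = 0 and r = r, unfolded zero])
      (simp_all add: p \<phi> dense dist)
qed

text \<open>A correspondence \<open>R'\<close> between the copies pulls back to a correspondence
  \<open>R\<close> between the originals, and every shift admissible for \<open>R'\<close> is
  admissible for \<open>R\<close>. This inequality carries upper bounds from the copies to the
  originals.\<close>

lemma CI_dist_kernel_linkage_mm_iso:
  assumes K: "kernel_function K" and M: "metric_prob_space M" and N: "metric_prob_space N"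
    and \<phi>: "mm_iso \<phi> M M'" and \<psi>: "mm_iso \<psi> N N'"
  shows "CI_dist (kernel_linkage K M) (kernel_linkage K N)
    \<le> CI_dist (kernel_linkage K M') (kernel_linkage K N')"
  unfolding CI_dist_def
proof (rule Inf_superset_mono, safe)
  fix \<eta> :: real and R'
  assume \<eta>: "0 \<le> \<eta>"
    and R': "correspondence (hc_set (kernel_linkage K M')) (hc_set (kernel_linkage K N')) R'"
    and il: "interleaved_wrt R' (\<chi> j. \<eta>) (kernel_linkage K M') (kernel_linkage K N')"
  define R where "R = {(x, y). x \<in> mspace (mm_metric M) \<and> y \<in> mspace (mm_metric N) \<and> (\<phi> x, \<psi> y) \<in> R'}"
  let ?\<Phi> = "map_prod \<phi> \<psi>"
  have R'1: "fst ` R' = \<phi> ` mspace (mm_metric M)" "snd ` R' = \<psi> ` mspace (mm_metric N)"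
    using R' \<phi> \<psi> by (auto simp: correspondence_def kernel_linkage_def mm_iso_def)
  have fst: "fst ` R = mspace (mm_metric M)"
  proof
    show "mspace (mm_metric M) \<subseteq> fst ` R"
    proof
      fix x assume x: "x \<in> mspace (mm_metric M)"
      then have "\<phi> x \<in> fst ` R'" using R'1 by blast
      then obtain b where b: "(\<phi> x, b) \<in> R'" by force
      then have "b \<in> \<psi> ` mspace (mm_metric N)" using R'1(2) by force
      then obtain y where "y \<in> mspace (mm_metric N)" "b = \<psi> y" by blast
      with b x have "(x, y) \<in> R" by (simp add: R_def)
      then show "x \<in> fst ` R" by force
    qed
  qed (auto simp: R_def)
  have snd: "snd ` R = mspace (mm_metric N)"
  proof
    show "mspace (mm_metric N) \<subseteq> snd ` R"
    proof
      fix y assume y: "y \<in> mspace (mm_metric N)"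
      then have "\<psi> y \<in> snd ` R'" using R'1 by blast
      then obtain a where a: "(a, \<psi> y) \<in> R'" by force
      then have "a \<in> \<phi> ` mspace (mm_metric M)" using R'1(1) by force
      then obtain x where "x \<in> mspace (mm_metric M)" "a = \<phi> x" by blast
      with a y have "(x, y) \<in> R" by (simp add: R_def)
      then show "y \<in> snd ` R" by force
    qed
  qed (auto simp: R_def)
  have \<Phi>: "?\<Phi> z \<in> R'" if "z \<in> R" for z
    using that by (auto simp: R_def)
  have \<Phi>1: "fst (?\<Phi> z) = \<phi> (fst z)" and \<Phi>2: "snd (?\<Phi> z) = \<psi> (snd z)" if "z \<in> R" for z
    by simp_all
  note tM = hc_ext_kernel_linkage_mm_iso[OF K M \<phi> fst \<Phi> \<Phi>1]
  note tN = hc_ext_kernel_linkage_mm_iso[OF K N \<psi> snd \<Phi> \<Phi>2]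
  have "interleaved_wrt R (\<chi> j. \<eta>) (kernel_linkage K M) (kernel_linkage K N)"
    unfolding interleaved_wrt_def interleaved_def
  proof (intro conjI allI)
    fix r
    have il1: "hc_ext (hc_pullback fst R' (kernel_linkage K M')) r
        \<preceq> hc_ext (hc_pullback snd R' (kernel_linkage K N')) (r + (\<chi> j. \<eta>))"
      and il2: "hc_ext (hc_pullback snd R' (kernel_linkage K N')) r
        \<preceq> hc_ext (hc_pullback fst R' (kernel_linkage K M')) (r + (\<chi> j. \<eta>))"
      using il unfolding interleaved_wrt_def interleaved_def by blast+
    show "hc_ext (hc_pullback fst R (kernel_linkage K M)) r
        \<preceq> hc_ext (hc_pullback snd R (kernel_linkage K N)) (r + (\<chi> j. \<eta>))"
      by (rule refines_trans[OF tM(1) refines_trans[OF clustering_pullback_mono[OF il1] tN(2)]])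
    show "hc_ext (hc_pullback snd R (kernel_linkage K N)) r
        \<preceq> hc_ext (hc_pullback fst R (kernel_linkage K M)) (r + (\<chi> j. \<eta>))"
      by (rule refines_trans[OF tN(1) refines_trans[OF clustering_pullback_mono[OF il2] tM(2)]])
  qed (simp add: hc_pullback_def)
  moreover have "correspondence (hc_set (kernel_linkage K M)) (hc_set (kernel_linkage K N)) R"
    using fst snd by (auto simp: correspondence_def R_def kernel_linkage_def)
  ultimately show "\<exists>\<epsilon>. ennreal \<eta> = ennreal \<epsilon> \<and> 0 \<le> \<epsilon> \<and>
     (\<exists>R. correspondence (hc_set (kernel_linkage K M)) (hc_set (kernel_linkage K N)) R \<and>
       interleaved_wrt R (\<chi> j. \<epsilon>) (kernel_linkage K M) (kernel_linkage K N))"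
    using \<eta> by blast
qed

section \<open>Isometric copies of both spaces in the reals\<close>

definition mm_image :: "('a \<Rightarrow> 'z) \<Rightarrow> 'z metric \<Rightarrow> 'a mm_space \<Rightarrow> 'z mm_space" where
  "mm_image \<phi> Z M = (let Y = submetric Z (\<phi> ` mspace (mm_metric M))
     in \<lparr>mm_metric = Y, mm_measure = distr (mm_measure M) (mborel Y) \<phi>\<rparr>)"

text \<open>Cutting \<open>Z\<close> down to the image makes \<open>\<phi>\<close> onto and lets
  compactness come from \<open>M\<close>. The last claim holds since the inclusion back into
  \<open>Z\<close> is continuous, hence measurable, so the two pushforwards compose.\<close>

lemma mm_image:
  assumes M: "compact_metric_prob_space M" and \<phi>: "isometric_embedding (mm_metric M) Z \<phi>"
  shows "compact_metric_prob_space (mm_image \<phi> Z M)" (is ?thesis1)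
    and "mm_iso \<phi> M (mm_image \<phi> Z M)" (is ?thesis2)
    and "isometric_embedding (mm_metric (mm_image \<phi> Z M)) Z id" (is ?thesis3)
    and "mspace (mm_metric (mm_image \<phi> Z M)) = \<phi> ` mspace (mm_metric M)" (is ?thesis4)
    and "distr (mm_measure (mm_image \<phi> Z M)) (mborel Z) id = distr (mm_measure M) (mborel Z) \<phi>"
      (is ?thesis5)
proof -
  let ?M' = "mm_image \<phi> Z M"
  let ?Y = "submetric Z (\<phi> ` mspace (mm_metric M))"
  have mps: "metric_prob_space M" using M by (simp add: compact_metric_prob_space_def)
  have M': "mm_metric ?M' = ?Y" "mm_measure ?M' = distr (mm_measure M) (mborel ?Y) \<phi>"
    by (simp_all add: mm_image_def)
  have sub: "\<phi> ` mspace (mm_metric M) \<subseteq> mspace Z"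
    using \<phi> by (simp add: isometric_embedding_def)
  then show ms: ?thesis4 unfolding M' by auto
  have \<phi>': "isometric_embedding (mm_metric M) ?Y \<phi>"
    using \<phi> sub by (auto simp: isometric_embedding_def)
  then show ?thesis2
    using ms by (simp add: mm_iso_def M')
  show id: ?thesis3
    using sub by (auto simp: isometric_embedding_def M')
  have mps': "metric_prob_space ?M'"
    using metric_prob_space_distr[OF mps \<phi>'] by (simp add: mm_image_def)
  have "compactin (mtopology_of Z) (\<phi> ` topspace (mtopology_of (mm_metric M)))"
    using M isometric_embedding_imp_continuous_map[OF \<phi>]
    by (intro image_compactin) (simp_all add: compact_metric_prob_space_def compact_space_def)
  then have "compact_space (mtopology_of ?Y)"
    by (simp add: mtopology_of_submetric compact_space_subtopology)
  then show ?thesis1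
    using mps' by (simp add: compact_metric_prob_space_def M')
  have "id \<in> measurable (mborel ?Y) (mborel Z)"
    using measurable_mborel_continuous[OF isometric_embedding_imp_continuous_map[OF id]]
    by (simp add: M')
  then show ?thesis5
    unfolding M'(2) using measurable_isometric_embedding[OF mps \<phi>']
    by (subst distr_distr) auto
qed

text \<open>Both pushforward measures are concentrated on the union \<open>C\<close> of the two
  images. The metric of \<open>C\<close> is carried along an injection \<open>g\<close> into the
  reals; Borel sets and thickenings on the two sides are matched through their traces on
  \<open>C\<close>, so the radius \<open>e\<close> is kept.\<close>

lemma ghp_within_real:
  fixes Z :: "'z metric"
  assumes M: "compact_metric_prob_space M" and N: "compact_metric_prob_space N"
    and ghp: "ghp_within e Z i j M N"
  obtains Z' :: "real metric" and M' N' \<phi> \<psi>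
  where "compact_metric_prob_space M'" "compact_metric_prob_space N'"
    "mm_iso \<phi> M M'" "mm_iso \<psi> N N'" "ghp_within e Z' id id M' N'"
proof -
  let ?XM = "mspace (mm_metric M)" and ?XN = "mspace (mm_metric N)"
  define C where "C = i ` ?XM \<union> j ` ?XN"
  have i: "isometric_embedding (mm_metric M) Z i" and j: "isometric_embedding (mm_metric N) Z j"
    and e: "0 < e" using ghp by (auto simp: ghp_within_def)
  have M1: "metric_prob_space M" and N1: "metric_prob_space N"
    using M N by (auto simp: compact_metric_prob_space_def)
  have "compactin (mtopology_of Z) (i ` topspace (mtopology_of (mm_metric M)))"
    "compactin (mtopology_of Z) (j ` topspace (mtopology_of (mm_metric N)))"
    using M N isometric_embedding_imp_continuous_map[OF i] isometric_embedding_imp_continuous_map[OF j]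
    by (intro image_compactin; simp add: compact_metric_prob_space_def compact_space_def)+
  then have C: "compactin (mtopology_of Z) C"
    by (simp add: C_def compactin_Un)
  then have CZ: "C \<subseteq> mspace Z" using compactin_subset_topspace[OF C] by simp
  obtain g :: "'z \<Rightarrow> real" where g: "inj_on g C"
    using ex_inj_on_real_compactin[OF C] by blast
  \<comment> \<open>The metric of \<open>C\<close> carried over by \<open>g\<close>; it is unrelated
    to the usual distance of the reals.\<close>
  define d where "d a b = mdist Z (inv_into C g a) (inv_into C g b)" for a b
  have gC: "inv_into C g (g z) = z" if "z \<in> C" for z using g that by simp
  have "Metric_space (g ` C) d"
    using CZ mdist_triangle[of _ Z] mdist_commute[of Z]
    by (auto simp: Metric_space_def d_def gC subset_iff)
  then interpret Metric_space "g ` C" d .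
  define Z' where "Z' = metric (g ` C, d)"
  have Z': "mspace Z' = g ` C" "mdist Z' = d" by (simp_all add: Z'_def)
  have dg: "d (g z) (g z') = mdist Z z z'" if "z \<in> C" "z' \<in> C" for z z'
    using that by (simp add: d_def gC)
  define \<phi> where "\<phi> = (\<lambda>x. g (i x))"
  define \<psi> where "\<psi> = (\<lambda>y. g (j y))"
  have iC: "i x \<in> C" if "x \<in> ?XM" for x using that by (simp add: C_def)
  have jC: "j y \<in> C" if "y \<in> ?XN" for y using that by (simp add: C_def)
  have \<phi>: "isometric_embedding (mm_metric M) Z' \<phi>" and \<psi>: "isometric_embedding (mm_metric N) Z' \<psi>"
    using i j by (auto simp: isometric_embedding_def Z' dg iC jC \<phi>_def \<psi>_def)
  have Csets: "C \<in> sets (mborel Z)" using C by (rule compactin_imp_sets_mborel)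
  have "isometric_embedding (submetric Z C) Z' g"
    using CZ by (auto simp: isometric_embedding_def Z' dg)
  then have "g \<in> measurable (mborel (submetric Z C)) (mborel Z')"
    by (intro measurable_mborel_continuous isometric_embedding_imp_continuous_map)
  \<comment> \<open>The preimage is Borel in the subspace \<open>C\<close>, hence in
    \<open>Z\<close> because \<open>C\<close> is Borel; there the Prokhorov condition of
    \<open>ghp\<close> can be applied to it.\<close>
  then have gset: "{z \<in> C. g z \<in> A} \<in> sets (mborel Z)" if "A \<in> sets (mborel Z')" for A
    using measurable_sets[OF _ that, of g "mborel (submetric Z C)"] CZ
    by (intro sets_mborel_submetric[OF Csets]) (simp add: vimage_def Int_def conj_commute subset_iff cong: conj_cong)
  \<comment> \<open>The match is restricted to points of \<open>C\<close>: the thickening in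
    \<open>Z\<close> may contain others, which carry no mass of either pushforward.\<close>
  have thick: "g z \<in> thickening Z' A e \<longleftrightarrow> z \<in> thickening Z {z \<in> C. g z \<in> A} e"
    if "z \<in> C" and sub: "A \<subseteq> g ` C" for z A
  proof
    assume "g z \<in> thickening Z' A e"
    then obtain a where a: "a \<in> A" "d (g z) a < e" by (auto simp: thickening_def Z')
    then obtain w where "w \<in> C" "a = g w" using sub by blast
    with a that CZ show "z \<in> thickening Z {z \<in> C. g z \<in> A} e"
      by (auto simp: thickening_def dg)
  next
    assume "z \<in> thickening Z {z \<in> C. g z \<in> A} e"
    then obtain w where "w \<in> C" "g w \<in> A" "mdist Z z w < e" by (auto simp: thickening_def)
    with that show "g z \<in> thickening Z' A e"
      by (auto simp: thickening_def Z' dg intro!: bexI[of _ "g w"])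
  qed
  have eM: "emeasure (distr (mm_measure M) (mborel Z') \<phi>) B = emeasure (distr (mm_measure M) (mborel Z) i) B0"
    if "B \<in> sets (mborel Z')" "B0 \<in> sets (mborel Z)" "\<And>z. z \<in> C \<Longrightarrow> g z \<in> B \<longleftrightarrow> z \<in> B0" for B B0
  proof -
    have "\<phi> -` B \<inter> space (mm_measure M) = i -` B0 \<inter> space (mm_measure M)"
      using that(3) iC by (auto simp: space_mm_measure[OF M1] \<phi>_def)
    then show ?thesis
      using that by (simp add: emeasure_distr measurable_isometric_embedding[OF M1] i \<phi>)
  qed
  have eN: "emeasure (distr (mm_measure N) (mborel Z') \<psi>) B = emeasure (distr (mm_measure N) (mborel Z) j) B0"
    if "B \<in> sets (mborel Z')" "B0 \<in> sets (mborel Z)" "\<And>z. z \<in> C \<Longrightarrow> g z \<in> B \<longleftrightarrow> z \<in> B0" for B B0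
  proof -
    have "\<psi> -` B \<inter> space (mm_measure N) = j -` B0 \<inter> space (mm_measure N)"
      using that(3) jC by (auto simp: space_mm_measure[OF N1] \<psi>_def)
    then show ?thesis
      using that by (simp add: emeasure_distr measurable_isometric_embedding[OF N1] j \<psi>)
  qed
  note mM = mm_image[OF M \<phi>] and mN = mm_image[OF N \<psi>]
  have "ghp_within e Z' id id (mm_image \<phi> Z' M) (mm_image \<psi> Z' N)"
    unfolding ghp_within_def mM(4,5) mN(4,5) image_id unfolding id_def
  proof (intro conjI ballI mM(3)[unfolded id_def] mN(3)[unfolded id_def] e)
    have "{z \<in> C. g z \<in> \<psi> ` ?XN} = j ` ?XN" "{z \<in> C. g z \<in> \<phi> ` ?XM} = i ` ?XM"
      using iC jC inj_onD[OF g] unfolding \<phi>_def \<psi>_def by blast+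
    then show "\<phi> ` ?XM \<subseteq> thickening Z' (\<psi> ` ?XN) e" "\<psi> ` ?XN \<subseteq> thickening Z' (\<phi> ` ?XM) e"
      using ghp thick[OF iC, of _ "\<psi> ` ?XN"] thick[OF jC, of _ "\<phi> ` ?XM"] iC jC
      unfolding ghp_within_def by (auto simp: \<phi>_def \<psi>_def image_subset_iff)
  next
    fix A assume A: "A \<in> sets (mborel Z')"
    let ?A0 = "{z \<in> C. g z \<in> A}"
    note A0 = gset[OF A]
    have AC: "A \<subseteq> g ` C" using sets.sets_into_space[OF A] by (simp add: Z')
    note t = sets_thickening[OF A, of e] sets_thickening[OF A0, of e] thick[OF _ AC]
    have 1: "emeasure (distr (mm_measure M) (mborel Z') \<phi>) A = emeasure (distr (mm_measure M) (mborel Z) i) ?A0"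
      "emeasure (distr (mm_measure M) (mborel Z') \<phi>) (thickening Z' A e)
        = emeasure (distr (mm_measure M) (mborel Z) i) (thickening Z ?A0 e)"
      by (intro eM t A A0; simp)+
    have 2: "emeasure (distr (mm_measure N) (mborel Z') \<psi>) A = emeasure (distr (mm_measure N) (mborel Z) j) ?A0"
      "emeasure (distr (mm_measure N) (mborel Z') \<psi>) (thickening Z' A e)
        = emeasure (distr (mm_measure N) (mborel Z) j) (thickening Z ?A0 e)"
      by (intro eN t A A0; simp)+
    show "emeasure (distr (mm_measure M) (mborel Z') \<phi>) A
        \<le> emeasure (distr (mm_measure N) (mborel Z') \<psi>) (thickening Z' A e) + ennreal e"
      "emeasure (distr (mm_measure N) (mborel Z') \<psi>) A
        \<le> emeasure (distr (mm_measure M) (mborel Z') \<phi>) (thickening Z' A e) + ennreal e"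
      unfolding 1 2 using ghp A0 unfolding ghp_within_def by blast+
  qed
  then show thesis using that mM(1,2) mN(1,2) by blast
qed


text \<open>The copies in the reals keep the radius \<open>e < \<delta>\<close>, so the assumed
  modulus applies to them, and its conclusion travels back along the isomorphisms.\<close>

lemma linkage_modulus_transfer:
  assumes K: "kernel_function K"
    and real: "linkage_modulus TYPE(real) TYPE(real) TYPE(real) K \<epsilon> \<delta>"
  shows "linkage_modulus TYPE('a) TYPE('b) TYPE('z) K \<epsilon> \<delta>"
  unfolding linkage_modulus_def
proof (intro allI impI)
  fix M :: "'a mm_space" and N :: "'b mm_space"
  assume M: "compact_metric_prob_space M" and N: "compact_metric_prob_space N"
    and "GHP_dist TYPE('z) M N < ennreal \<delta>"
  then obtain e i j and Z :: "'z metric" where e: "e < \<delta>" and ghp: "ghp_within e Z i j M N"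
    by (elim GHP_dist_less_obtain)
  obtain Z' :: "real metric" and M' N' \<phi> \<psi>
    where M': "compact_metric_prob_space M'" and N': "compact_metric_prob_space N'"
      and \<phi>: "mm_iso \<phi> M M'" and \<psi>: "mm_iso \<psi> N N'" and ghp': "ghp_within e Z' id id M' N'"
    by (rule ghp_within_real[OF M N ghp])
  have "0 < e" using ghp by (simp add: ghp_within_def)
  then have "GHP_dist TYPE(real) M' N' < ennreal \<delta>"
    using GHP_dist_le[OF ghp'] e by (elim le_less_trans) (simp add: ennreal_less_iff)
  then have "CI_dist (kernel_linkage K M') (kernel_linkage K N') < ennreal \<epsilon>"
    using real M' N' unfolding linkage_modulus_def by blast
  with M N show "CI_dist (kernel_linkage K M) (kernel_linkage K N) < ennreal \<epsilon>"
    using CI_dist_kernel_linkage_mm_iso[OF K _ _ \<phi> \<psi>]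
    by (auto simp: compact_metric_prob_space_def intro: le_less_trans)
qed

section \<open>Uniform continuity and the Lipschitz bound\<close>

lemma linkage_modulus_exists:
  assumes K: "kernel_function K" and \<epsilon>: "0 < \<epsilon>"
  shows "\<exists>\<delta>>0. linkage_modulus TYPE('a) TYPE('b) TYPE('z) K \<epsilon> \<delta>"
proof -
  \<comment> \<open>Half of \<open>\<epsilon>\<close>, because the interleaving bound is not strict
    while the conclusion is. This \<open>\<delta>\<close> is chosen from \<open>K\<close> and
    \<open>\<epsilon>\<close> before any space is fixed.\<close>
  obtain \<delta> c where "0 < \<delta>" and \<delta>: "\<And>e. 0 < e \<Longrightarrow> e < \<delta> \<Longrightarrow> kernel_shift K e (\<epsilon> / 2) c"
    using kernel_shift_exists[OF K, of "\<epsilon> / 2"] \<epsilon> by auto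
  have "linkage_modulus TYPE('a) TYPE('b) TYPE('z) K \<epsilon> \<delta>"
    unfolding linkage_modulus_def
  proof (intro allI impI)
    fix M :: "'a mm_space" and N :: "'b mm_space"
    assume MN: "compact_metric_prob_space M" "compact_metric_prob_space N"
      and "GHP_dist TYPE('z) M N < ennreal \<delta>"
    then obtain e i j and Z :: "'z metric" where e: "e < \<delta>" and ghp: "ghp_within e Z i j M N"
      by (elim GHP_dist_less_obtain)
    have "0 < e" using ghp by (simp add: ghp_within_def)
    with e have "CI_dist (kernel_linkage K M) (kernel_linkage K N) \<le> ennreal (\<epsilon> / 2)"
      using MN by (intro CI_dist_kernel_linkage_le[OF K _ _ ghp \<delta>])
        (auto simp: compact_metric_prob_space_def)
    also have "\<dots> < ennreal \<epsilon>" using \<epsilon> by (simp add: ennreal_less_iff)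
    finally show "CI_dist (kernel_linkage K M) (kernel_linkage K N) < ennreal \<epsilon>" .
  qed
  with \<open>0 < \<delta>\<close> show ?thesis by blast
qed

text \<open>An infimum need not be attained, so the bound is shown for every \<open>x\<close> above
  the right side. If \<open>x\<close> is a finite \<open>a\<close>, a witness with
  \<open>e < a / 2\<close> gives the shift \<open>2 * e < a\<close>.\<close>

lemma CI_dist_uniform_kernel_linkage_le:
  fixes M :: "'a mm_space" and N :: "'b mm_space"
  assumes K: "kernel_function K" and uniform: "\<forall>r\<ge>0. K r = uniform_kernel r"
    and M: "metric_prob_space M" and N: "metric_prob_space N"
  shows "CI_dist (kernel_linkage K M) (kernel_linkage K N) \<le> 2 * GHP_dist TYPE('z) M N"
proof (rule dense_ge)
  fix x assume x: "2 * GHP_dist TYPE('z) M N < x"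
  show "CI_dist (kernel_linkage K M) (kernel_linkage K N) \<le> x"
  proof (cases x)
    case (real a)
    have "GHP_dist TYPE('z) M N < ennreal (a / 2)"
    proof (rule ccontr)
      assume "\<not> ?thesis"
      then have "2 * ennreal (a / 2) \<le> 2 * GHP_dist TYPE('z) M N"
        by (intro mult_left_mono) auto
      moreover have "2 * ennreal (a / 2) = x"
        using real ennreal_mult[of 2 "a / 2"] by simp
      ultimately show False using x by simp
    qed
    then obtain e i j and Z :: "'z metric" where e: "e < a / 2" and ghp: "ghp_within e Z i j M N"
      by (rule GHP_dist_less_obtain)
    have "0 < e" using ghp by (simp add: ghp_within_def)
    have "CI_dist (kernel_linkage K M) (kernel_linkage K N) \<le> ennreal (2 * e)"
      by (rule CI_dist_kernel_linkage_le[OF K M N ghp kernel_shift_uniform[OF uniform \<open>0 < e\<close>]])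
    also have "\<dots> \<le> x" using e real by (simp add: ennreal_leI)
    finally show ?thesis .
  qed simp
qed

theorem theorem38:
  fixes K :: "real \<Rightarrow> real"
  assumes "kernel_function K"
  shows
    "(\<forall>\<epsilon>>0.
        (\<exists>\<delta>>0. linkage_modulus TYPE(real) TYPE(real) TYPE(real) K \<epsilon> \<delta>) \<and>
        (\<forall>\<delta>>0. linkage_modulus TYPE(real) TYPE(real) TYPE(real) K \<epsilon> \<delta> \<longrightarrow>
                linkage_modulus TYPE('a) TYPE('b) TYPE('z) K \<epsilon> \<delta>))
     \<and>
     ((\<forall>r\<ge>0. K r = uniform_kernel r) \<longrightarrow>
        (\<forall>(M :: 'a mm_space) (N :: 'b mm_space).
           compact_metric_prob_space M \<longrightarrow> compact_metric_prob_space N \<longrightarrow>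
           CI_dist (kernel_linkage K M) (kernel_linkage K N) \<le> 2 * GHP_dist TYPE('z) M N))"
  using linkage_modulus_exists[OF assms] linkage_modulus_transfer[OF assms]
    CI_dist_uniform_kernel_linkage_le[OF assms]
  by (auto simp: compact_metric_prob_space_def)

end
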